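(* Given a graph $G=(V,E)$ with edge weights $w\in\mathbb{R}_{\geq0}^E$, vertex capacities $c\in\mathbb{Z}_{\geq0}^V$, and a $c$-matching $M$ of $G$ (not necessarily of maximum weight), the problem of computing a minimum-cardinality set $S\subseteq V$ such that $G\setminus S$ is stable and $M$ is a maximum-weight $c$-matching in $G\setminus S$ admits an efficient (polynomial-time) 2-approximation algorithm.
   Context: A $c$-matching of $G=(V,E)$ with capacities $c\in\mathbb{Z}_{\geq0}^V$ is a set $M\subseteq E$ such that every vertex $v$ is incident to at most $c_v$ edges of $M$. For edge weights $w\geq 0$, $\nu^c(G)$ denotes the maximum weight of a $c$-matching, and $\nu_f^c(G):=\max\{w^\top x : \sum_{u: uv\in E}x_{uv}\leq c_v\ \forall v\in V,\ 0\leq x\leq 1\}$. The graph is stable if $\nu^c(G)=\nu_f^c(G)$. For $S\subseteq V$, $G\setminus S$ is the subgraph induced by $V\setminus S$ with inherited weights and capacities; the requirement that $M$ be a maximum-weight $c$-matching in $G\setminus S$ includes that all edges of $M$ lie in $G\setminus S$. *)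

theory Defs
  imports Complex_Main "HOL-Computational_Algebra.Polynomial"
begin

section \<open>Capacitated matchings and stability\<close>

definition simple_graph :: "'v set \<Rightarrow> 'v set set \<Rightarrow> bool" where
  "simple_graph V E \<longleftrightarrow> finite V \<and> (\<forall>e\<in>E. e \<subseteq> V \<and> card e = 2)"

definition c_matching :: "'v set \<Rightarrow> 'v set set \<Rightarrow> ('v \<Rightarrow> nat) \<Rightarrow> 'v set set \<Rightarrow> bool" where
  "c_matching V E c M \<longleftrightarrow> M \<subseteq> E \<and> (\<forall>v\<in>V. card {e\<in>M. v \<in> e} \<le> c v)"

definition nu :: "'v set \<Rightarrow> 'v set set \<Rightarrow> ('v set \<Rightarrow> real) \<Rightarrow> ('v \<Rightarrow> nat) \<Rightarrow> real" where
  "nu V E w c = Max {sum w M | M. c_matching V E c M}"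

definition fractional_c_matching ::
  "'v set \<Rightarrow> 'v set set \<Rightarrow> ('v \<Rightarrow> nat) \<Rightarrow> ('v set \<Rightarrow> real) \<Rightarrow> bool" where
  "fractional_c_matching V E c x \<longleftrightarrow>
     (\<forall>v\<in>V. (\<Sum>e\<in>{e\<in>E. v \<in> e}. x e) \<le> real (c v)) \<and> (\<forall>e\<in>E. 0 \<le> x e \<and> x e \<le> 1)"

text \<open>For a finite graph the feasible region is a nonempty polytope (only the values of \<open>x\<close> on
  \<open>E\<close> matter), so the supremum is attained and is the maximum of the linear program.\<close>

definition nu_f :: "'v set \<Rightarrow> 'v set set \<Rightarrow> ('v set \<Rightarrow> real) \<Rightarrow> ('v \<Rightarrow> nat) \<Rightarrow> real" where
  "nu_f V E w c = Sup {(\<Sum>e\<in>E. w e * x e) | x. fractional_c_matching V E c x}"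

definition stable :: "'v set \<Rightarrow> 'v set set \<Rightarrow> ('v set \<Rightarrow> real) \<Rightarrow> ('v \<Rightarrow> nat) \<Rightarrow> bool" where
  "stable V E w c \<longleftrightarrow> nu V E w c = nu_f V E w c"

definition max_weight_c_matching ::
  "'v set \<Rightarrow> 'v set set \<Rightarrow> ('v set \<Rightarrow> real) \<Rightarrow> ('v \<Rightarrow> nat) \<Rightarrow> 'v set set \<Rightarrow> bool" where
  "max_weight_c_matching V E w c M \<longleftrightarrow>
     c_matching V E c M \<and> (\<forall>N. c_matching V E c N \<longrightarrow> sum w N \<le> sum w M)"

definition induced_edges :: "'v set set \<Rightarrow> 'v set \<Rightarrow> 'v set set" where
  "induced_edges E U = {e\<in>E. e \<subseteq> U}"

definition M_vertex_stabilizer ::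
  "'v set \<Rightarrow> 'v set set \<Rightarrow> ('v set \<Rightarrow> real) \<Rightarrow> ('v \<Rightarrow> nat) \<Rightarrow> 'v set set \<Rightarrow> 'v set \<Rightarrow> bool" where
  "M_vertex_stabilizer V E w c M S \<longleftrightarrow>
     S \<subseteq> V \<and>
     stable (V - S) (induced_edges E (V - S)) w c \<and>
     max_weight_c_matching (V - S) (induced_edges E (V - S)) w c M"


section \<open>Machine model\<close>

text \<open>
  Since the edge weights are arbitrary real numbers, the model of computation is a random access
  machine with one memory of natural numbers and one memory of real numbers, programmed by
  structured programs; every operation, memory access and test costs one unit.

  The model is deliberately restricted so that unit costs are honest. The only arithmetic is
  addition and subtraction (truncated on naturals), so in \<open>t\<close> time units the largest absolute value
  in memory grows by a factor of at most exponential in \<open>t\<close>; on rational weights, polynomially many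
  steps therefore give a polynomial-time algorithm in the bit model as well. The only real
  constant is \<open>0\<close>, so that no information can be hidden in the program, and reals can influence
  control flow only through comparisons.
\<close>

type_synonym state = "(nat \<Rightarrow> nat) \<times> (nat \<Rightarrow> real)"

datatype nexp = NConst nat | NLoad nexp | NAdd nexp nexp | NSub nexp nexp

datatype rexp = RZero | RLoad nexp | RAdd rexp rexp | RSub rexp rexp

datatype bexp = NLess nexp nexp | RLess rexp rexp | BNot bexp | BAnd bexp bexp

datatype com =
    Skip
  | NStore nexp nexp
  | RStore nexp rexp
  | Seq com com
  | Cond bexp com com
  | While bexp com

fun nval :: "nexp \<Rightarrow> state \<Rightarrow> nat" where
  "nval (NConst k) s = k"
| "nval (NLoad a) s = fst s (nval a s)"
| "nval (NAdd a b) s = nval a s + nval b s"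
| "nval (NSub a b) s = nval a s - nval b s"

fun rval :: "rexp \<Rightarrow> state \<Rightarrow> real" where
  "rval RZero s = 0"
| "rval (RLoad a) s = snd s (nval a s)"
| "rval (RAdd a b) s = rval a s + rval b s"
| "rval (RSub a b) s = rval a s - rval b s"

fun bval :: "bexp \<Rightarrow> state \<Rightarrow> bool" where
  "bval (NLess a b) s \<longleftrightarrow> nval a s < nval b s"
| "bval (RLess a b) s \<longleftrightarrow> rval a s < rval b s"
| "bval (BNot b) s \<longleftrightarrow> \<not> bval b s"
| "bval (BAnd a b) s \<longleftrightarrow> bval a s \<and> bval b s"

fun ncost :: "nexp \<Rightarrow> nat" where
  "ncost (NConst k) = 1"
| "ncost (NLoad a) = 1 + ncost a"
| "ncost (NAdd a b) = 1 + ncost a + ncost b"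
| "ncost (NSub a b) = 1 + ncost a + ncost b"

fun rcost :: "rexp \<Rightarrow> nat" where
  "rcost RZero = 1"
| "rcost (RLoad a) = 1 + ncost a"
| "rcost (RAdd a b) = 1 + rcost a + rcost b"
| "rcost (RSub a b) = 1 + rcost a + rcost b"

fun bcost :: "bexp \<Rightarrow> nat" where
  "bcost (NLess a b) = 1 + ncost a + ncost b"
| "bcost (RLess a b) = 1 + rcost a + rcost b"
| "bcost (BNot b) = 1 + bcost b"
| "bcost (BAnd a b) = 1 + bcost a + bcost b"

text \<open>\<open>exec P s t s'\<close>: started in state \<open>s\<close>, the program \<open>P\<close> halts in state \<open>s'\<close> at total cost \<open>t\<close>.\<close>

inductive exec :: "com \<Rightarrow> state \<Rightarrow> nat \<Rightarrow> state \<Rightarrow> bool" where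
  Skip: "exec Skip s 1 s"
| NStore: "exec (NStore a b) s (1 + ncost a + ncost b) ((fst s)(nval a s := nval b s), snd s)"
| RStore: "exec (RStore a b) s (1 + ncost a + rcost b) (fst s, (snd s)(nval a s := rval b s))"
| Seq: "exec P s t s' \<Longrightarrow> exec Q s' t' s'' \<Longrightarrow> exec (Seq P Q) s (t + t') s''"
| CondTrue: "bval b s \<Longrightarrow> exec P s t s' \<Longrightarrow> exec (Cond b P Q) s (1 + bcost b + t) s'"
| CondFalse: "\<not> bval b s \<Longrightarrow> exec Q s t s' \<Longrightarrow> exec (Cond b P Q) s (1 + bcost b + t) s'"
| WhileFalse: "\<not> bval b s \<Longrightarrow> exec (While b P) s (1 + bcost b) s"
| WhileTrue: "bval b s \<Longrightarrow> exec P s t s' \<Longrightarrow> exec (While b P) s' t' s'' \<Longrightarrow>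
    exec (While b P) s (1 + bcost b + t + t') s''"

inductive_cases exec_SkipE: "exec Skip s t s'"
inductive_cases exec_NStoreE: "exec (NStore a b) s t s'"
inductive_cases exec_RStoreE: "exec (RStore a b) s t s'"
inductive_cases exec_SeqE: "exec (Seq P Q) s t s'"
inductive_cases exec_CondE: "exec (Cond b P Q) s t s'"
inductive_cases exec_WhileE: "exec (While b P) s t s'"

lemma exec_deterministic:
  assumes "exec P s t1 s1" and "exec P s t2 s2"
  shows "t1 = t2 \<and> s1 = s2"
  using assms
proof (induction arbitrary: t2 s2 rule: exec.induct)
  case (Skip s)
  then show ?case by (auto elim: exec_SkipE)
next
  case (NStore a b s)
  then show ?case by (auto elim: exec_NStoreE)
next
  case (RStore a b s)
  then show ?case by (auto elim: exec_RStoreE)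
next
  case (Seq P s t s' Q t' s'')
  from Seq.prems show ?case
    by (rule exec_SeqE) (use Seq.IH in metis)+
next
  case (CondTrue b s P t s' Q)
  from CondTrue.prems CondTrue.hyps(1) obtain u where "t2 = 1 + bcost b + u" "exec P s u s2"
    by (auto elim: exec_CondE)
  then show ?case using CondTrue.IH[of u s2] by simp
next
  case (CondFalse b s Q t s' P)
  from CondFalse.prems CondFalse.hyps(1) obtain u where "t2 = 1 + bcost b + u" "exec Q s u s2"
    by (auto elim: exec_CondE)
  then show ?case using CondFalse.IH[of u s2] by simp
next
  case (WhileFalse b s P)
  from WhileFalse.prems show ?case
    by (rule exec_WhileE) (use WhileFalse.hyps in simp_all)
next
  case (WhileTrue b s P t s' t' s'')
  from WhileTrue.prems WhileTrue.hyps(1) obtain u r u'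
    where *: "t2 = 1 + bcost b + u + u'" "exec P s u r" "exec (While b P) r u' s2"
    by (auto elim: exec_WhileE)
  with WhileTrue.IH(1)[of u r] have "t = u" "s' = r" by auto
  with * WhileTrue.IH(2)[of u' s2] show ?case by simp
qed


section \<open>Encoding of instances and solutions\<close>

text \<open>An instance on the vertices \<open>0, \<dots>, n - 1\<close> is presented by listing every edge exactly once,
  in any order and with either order of its endpoints.\<close>

definition edge_list :: "nat set set \<Rightarrow> (nat \<times> nat) list \<Rightarrow> bool" where
  "edge_list E es \<longleftrightarrow>
     distinct (map (\<lambda>(u, v). {u, v}) es) \<and> set (map (\<lambda>(u, v). {u, v}) es) = E"

definition nat_input ::
  "nat \<Rightarrow> (nat \<times> nat) list \<Rightarrow> (nat \<Rightarrow> nat) \<Rightarrow> nat set set \<Rightarrow> nat list" where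
  "nat_input n es c M =
     [n, length es] @ map c [0..<n] @
     concat (map (\<lambda>(u, v). [u, v, if {u, v} \<in> M then 1 else 0]) es)"

definition real_input :: "(nat \<times> nat) list \<Rightarrow> (nat set \<Rightarrow> real) \<Rightarrow> real list" where
  "real_input es w = map (\<lambda>(u, v). w {u, v}) es"

definition load_memory :: "'a::zero list \<Rightarrow> nat \<Rightarrow> 'a" where
  "load_memory xs i = (if i < length xs then xs ! i else 0)"

definition initial_state ::
  "nat \<Rightarrow> (nat \<times> nat) list \<Rightarrow> (nat set \<Rightarrow> real) \<Rightarrow> (nat \<Rightarrow> nat) \<Rightarrow> nat set set \<Rightarrow> state" where
  "initial_state n es w c M = (load_memory (nat_input n es c M), load_memory (real_input es w))"

definition input_size ::
  "nat \<Rightarrow> (nat \<times> nat) list \<Rightarrow> (nat set \<Rightarrow> real) \<Rightarrow> (nat \<Rightarrow> nat) \<Rightarrow> nat set set \<Rightarrow> nat" where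
  "input_size n es w c M = length (nat_input n es c M) + length (real_input es w)"

text \<open>Cell \<open>0\<close> of the final natural-number memory tells whether a solution is reported
  (\<open>0\<close> means ``infeasible''); the following \<open>n\<close> cells hold the membership flags of the solution.\<close>

definition reported_solution :: "nat \<Rightarrow> state \<Rightarrow> nat set option" where
  "reported_solution n s = (if fst s 0 = 0 then None else Some {v. v < n \<and> fst s (Suc v) \<noteq> 0})"

end

theory Submission
  imports Defs "HOL-Library.Multiset"
begin

text \<open>
  A set \<open>S\<close> is a solution iff it consists of vertices exposed by \<open>M\<close> and \<open>M\<close> is an optimal fractional
  matching of \<open>G - S\<close>. The latter holds iff the residual digraph of \<open>M\<close> in the bipartite double cover
  of \<open>G - S\<close> has no cycle of positive gain: a positive cycle can be used to improve \<open>M\<close> fractionally,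
  and without one the Bellman--Ford labels give an optimal dual solution. A simple residual cycle
  contains at most two exposed vertices, one next to the source and one next to the sink. Hence \<open>S\<close> is a
  solution iff it meets all pairs \<open>{a, b}\<close> of exposed vertices (possibly \<open>a = b\<close>) for which there is a
  positive cycle once all exposed vertices but \<open>a\<close> and \<open>b\<close> are deleted, provided that there is none
  when all exposed vertices are deleted. Greedily taking both members of disjoint pairs of this kind
  therefore costs at most twice the optimum.
\<close>

section \<open>Walks of positive gain\<close>

text \<open>The graph need not be bipartite. In the double cover the linear program becomes a flow
  problem, at the price that a cycle may use an edge of \<open>G\<close> through both orientations.
  This is harmless, because the improvement need not be integral: all changes along a closed walk
  are projected to \<open>E\<close>, summed and divided by the length of the walk. In the other
  direction the two copies of a vertex are averaged into its dual value. Identifying source and sink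
  turns improving paths between unsaturated vertices into cycles, so that one test covers paths and
  cycles alike. Whether a pair is bad does not depend on the vertices marked so far; every pair
  found is thus an obstruction for all stabilizers, which is what the factor 2 rests on. The program
  itself only adds, subtracts and compares; halving and division occur in the proofs alone.\<close>

type_synonym arc = "nat \<times> nat \<times> real"

fun walk :: "arc set \<Rightarrow> nat \<Rightarrow> arc list \<Rightarrow> nat \<Rightarrow> bool" where
  "walk A x [] y \<longleftrightarrow> x = y"
| "walk A x (a # p) y \<longleftrightarrow> a \<in> A \<and> fst a = x \<and> walk A (fst (snd a)) p y"

definition gain :: "arc list \<Rightarrow> real" where
  "gain p = (\<Sum>a\<leftarrow>p. snd (snd a))"

definition pos_cycle :: "arc set \<Rightarrow> bool" where
  "pos_cycle A \<longleftrightarrow> (\<exists>x p. walk A x p x \<and> 0 < gain p)"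

lemma gain_simps [simp]: "gain [] = 0" "gain (a # p) = snd (snd a) + gain p"
    "gain (p @ q) = gain p + gain q"
  by (simp_all add: gain_def)

lemma walk_append: "walk A x (p @ q) y \<longleftrightarrow> (\<exists>z. walk A x p z \<and> walk A z q y)"
  by (induction p arbitrary: x) auto

lemma walk_arcs: "walk A x p y \<Longrightarrow> set p \<subseteq> A"
  by (induction p arbitrary: x) auto

lemma walk_mono: "walk A x p y \<Longrightarrow> set p \<subseteq> B \<Longrightarrow> walk B x p y"
  by (induction p arbitrary: x) auto

lemma pos_cycle_mono: "pos_cycle A \<Longrightarrow> A \<subseteq> B \<Longrightarrow> pos_cycle B"
  unfolding pos_cycle_def by (meson order_trans walk_arcs walk_mono)

lemma walk_telescope:
  fixes f :: "nat \<Rightarrow> real"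
  shows "walk A x p y \<Longrightarrow> (\<Sum>a\<leftarrow>p. f (fst (snd a)) - f (fst a)) = f y - f x"
  by (induction p arbitrary: x) auto

text \<open>Every visit to an inner node is one arrival and one departure. For a closed walk the
  sources and the targets form the same multiset, so distinct sources yield distinct
  targets.\<close>

lemma walk_endpoints:
  "walk A x p y \<Longrightarrow> mset (map fst p) + {#y#} = mset (map (fst \<circ> snd) p) + {#x#}"
proof (induction p arbitrary: x)
  case (Cons a p)
  from Cons.prems have "fst a = x" "walk A (fst (snd a)) p y" by auto
  with Cons.IH[of "fst (snd a)"] show ?case by (simp add: union_commute)
qed simp

text \<open>Only sources of arcs are compared, so the return of a simple closed walk to its start is
  no repetition. Both pieces are therefore strictly shorter, as the inductions on length
  require.\<close>

lemma walk_extract_loop: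
  assumes "walk A x p y" "\<not> distinct (map fst p)"
  obtains p' q z where "walk A x p' y" "walk A z q z" "length p' < length p" "length q < length p"
    "gain p = gain p' + gain q"
proof -
  from not_distinct_decomp[OF assms(2)] obtain xs z ys zs
    where "map fst p = xs @ [z] @ ys @ [z] @ zs" by blast
  then obtain p1 a p2 b p3 where p: "p = p1 @ (a # p2) @ (b # p3)" and ab: "fst a = z" "fst b = z"
    by (fastforce simp: map_eq_append_conv append_eq_map_conv map_eq_Cons_conv Cons_eq_map_conv)
  from assms(1) ab have "walk A x p1 z" "walk A z (a # p2) z" "walk A z (b # p3) y"
    unfolding p walk_append by auto
  then have "walk A x (p1 @ b # p3) y" unfolding walk_append by blast
  show thesis
    by (rule that[OF \<open>walk A x (p1 @ b # p3) y\<close> \<open>walk A z (a # p2) z\<close>])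
       (cases p1; simp add: p)+
qed

text \<open>Gain is additive over the two pieces of a cut, so one of the two shorter closed walks is
  again positive.\<close>

lemma pos_cycle_distinct:
  assumes "pos_cycle A"
  obtains x p where "walk A x p x" "0 < gain p" "distinct (map fst p)"
proof -
  have "\<exists>x p. walk A x p x \<and> 0 < gain p \<and> distinct (map fst p)"
    if "walk A x p x" "0 < gain p" for x p
    using that
  proof (induction "length p" arbitrary: x p rule: less_induct)
    case less
    show ?case
    proof (cases "distinct (map fst p)")
      case False
      then obtain p' q z where *: "walk A x p' x" "walk A z q z" "length p' < length p"
          "length q < length p" "gain p = gain p' + gain q"
        using walk_extract_loop[OF less.prems(1)] by metis
      show ?thesis
      proof (cases "0 < gain q")
        case True
        then show ?thesis using less.hyps * by blast
      next
        case False
        then have "0 < gain p'" using * less.prems by simp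
        then show ?thesis using less.hyps * by blast
      qed
    qed (use less.prems in blast)
  qed
  with assms that show thesis unfolding pos_cycle_def by metis
qed

text \<open>Loops of nonpositive gain are cut out without loss; distinct sources below
  \<open>N\<close> leave at most \<open>N\<close> arcs.\<close>

lemma short_walk:
  assumes "\<not> pos_cycle A" "\<And>a. a \<in> A \<Longrightarrow> fst a < N" "walk A x p y"
  obtains q where "walk A x q y" "gain p \<le> gain q" "length q \<le> N"
proof -
  have "\<exists>q. walk A x q y \<and> gain p \<le> gain q \<and> length q \<le> N" if "walk A x p y" for p
    using that
  proof (induction "length p" arbitrary: p rule: less_induct)
    case less
    show ?case
    proof (cases "distinct (map fst p)")
      case True
      have "set (map fst p) \<subseteq> {..<N}" using walk_arcs[OF less.prems] assms(2) by auto
      then have "card (set (map fst p)) \<le> N" using card_mono[of "{..<N}"] by fastforce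
      with True have "length p \<le> N" by (metis distinct_card length_map)
      then show ?thesis using less.prems by auto
    next
      case False
      then obtain p' q z where *: "walk A x p' y" "walk A z q z" "length p' < length p"
          "gain p = gain p' + gain q"
        using walk_extract_loop[OF less.prems] by metis
      have "gain q \<le> 0" using assms(1) *(2) unfolding pos_cycle_def by force
      with * less.hyps[of p'] show ?thesis by fastforce
    qed
  qed
  with assms(3) that show thesis by blast
qed

section \<open>Label correction as a test for positive cycles\<close>

fun relax :: "arc \<Rightarrow> (nat \<Rightarrow> real) \<times> bool \<Rightarrow> (nat \<Rightarrow> real) \<times> bool" where
  "relax (x, y, g) (d, f) = (if d y < d x + g then (d(y := d x + g), True) else (d, f))"

definition potential :: "arc set \<Rightarrow> (nat \<Rightarrow> real) \<Rightarrow> bool" where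
  "potential A d \<longleftrightarrow> (\<forall>(x, y, g) \<in> A. d x + g \<le> d y)"

lemma potential_no_pos_cycle:
  assumes "potential A d"
  shows "\<not> pos_cycle A"
proof -
  have "gain p \<le> d y - d x" if "walk A x p y" for x y p
    using that
  proof (induction p arbitrary: x)
    case (Cons a p)
    then have "d (fst a) + snd (snd a) \<le> d (fst (snd a))"
      using assms unfolding potential_def by (cases a) auto
    with Cons show ?case by fastforce
  qed simp
  then show ?thesis unfolding pos_cycle_def by fastforce
qed

text \<open>The flag is never lowered within a fold. If it stays down, no label was changed, so all
  arcs were tested against the same \<open>d\<close>.\<close>

lemma fold_relax_unflagged:
  "\<not> snd (fold relax as (d, f)) \<Longrightarrow> \<not> f \<and> potential (set as) d"
proof (induction as arbitrary: d f)
  case (Cons a as)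
  obtain x y g where a: "a = (x, y, g)" by (cases a)
  show ?case
  proof (cases "d y < d x + g")
    case True
    then show ?thesis using Cons a by force
  next
    case False
    then show ?thesis using Cons a by (auto simp: potential_def)
  qed
qed (auto simp: potential_def)

lemma fold_relax_potential: "potential (set as) d \<Longrightarrow> fold relax as (d, f) = (d, f)"
  by (induction as) (auto simp: potential_def)

lemma fold_relax_mono: "d z \<le> fst (fold relax as (d, f)) z"
proof (induction as arbitrary: d f)
  case (Cons a as)
  obtain x y g where a: "a = (x, y, g)" by (cases a)
  obtain d' f' where r: "relax a (d, f) = (d', f')" by (cases "relax a (d, f)")
  have "d z \<le> d' z" using r by (auto simp: a split: if_splits)
  also have "\<dots> \<le> fst (fold relax as (d', f')) z" by (rule Cons.IH)
  finally show ?case by (simp add: r)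
qed simp

text \<open>Labels only grow: relaxations before the arc can only raise \<open>d x\<close>, and
  those after it keep the bound reached at \<open>y\<close>.\<close>

lemma fold_relax_arc: "(x, y, g) \<in> set as \<Longrightarrow> d x + g \<le> fst (fold relax as (d, f)) y"
proof (induction as arbitrary: d f)
  case (Cons a as)
  obtain d' f' where r: "relax a (d, f) = (d', f')" by (cases "relax a (d, f)")
  show ?case
  proof (cases "a = (x, y, g)")
    case True
    have "d x + g \<le> d' y" using r True by (auto split: if_splits)
    also have "\<dots> \<le> fst (fold relax as (d', f')) y" by (rule fold_relax_mono)
    finally show ?thesis by (simp add: r)
  next
    case False
    have "d x \<le> d' x" using fold_relax_mono[of d x "[a]" f] by (simp add: r)
    also have "d' x + g \<le> fst (fold relax as (d', f')) y" using False Cons by auto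
    finally show ?thesis by (simp add: r)
  qed
qed simp

text \<open>Soundness half of the invariant: each label is attained by an actual walk. No starting
  node is fixed; every node has a real label from the outset, so positive cycles are detected
  without a reachability condition.\<close>

definition walk_values :: "arc set \<Rightarrow> (nat \<Rightarrow> real) \<Rightarrow> (nat \<Rightarrow> real) \<Rightarrow> bool" where
  "walk_values A d0 d \<longleftrightarrow> (\<forall>y. \<exists>x p. walk A x p y \<and> d y = d0 x + gain p)"

lemma walk_values_refl: "walk_values A d d"
  unfolding walk_values_def by (metis add.right_neutral gain_simps(1) walk.simps(1))

lemma walk_values_relax:
  "walk_values A d0 d \<Longrightarrow> set as \<subseteq> A \<Longrightarrow> walk_values A d0 (fst (fold relax as (d, f)))"
proof (induction as arbitrary: d f)
  case (Cons a as)
  obtain x y g where a: "a = (x, y, g)" by (cases a)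
  obtain d' f' where r: "relax a (d, f) = (d', f')" by (cases "relax a (d, f)")
  from Cons.prems obtain z p where p: "walk A z p x" "d x = d0 z + gain p"
    unfolding walk_values_def by blast
  have "walk A z (p @ [a]) y" "d x + g = d0 z + gain (p @ [a])"
    using p Cons.prems(2) by (auto simp: walk_append a)
  with Cons.prems(1) r have "walk_values A d0 d'"
    unfolding walk_values_def by (fastforce simp: a split: if_splits)
  with Cons show ?case by (simp add: r)
qed simp

text \<open>Clearing the flag makes the result report the last pass only; earlier passes may change
  labels even without a positive cycle.\<close>

definition pass :: "arc list \<Rightarrow> (nat \<Rightarrow> real) \<times> bool \<Rightarrow> (nat \<Rightarrow> real) \<times> bool" where
  "pass as df = fold relax as (fst df, False)"

lemma passes_Suc:
  "(pass as ^^ Suc k) df = fold relax as (fst ((pass as ^^ k) df), False)"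
  by (simp add: pass_def[of _ "(pass as ^^ k) df"])

lemma walk_values_passes: "walk_values (set as) d (fst ((pass as ^^ k) (d, f)))"
  by (induction k) (simp_all add: walk_values_refl walk_values_relax passes_Suc del: funpow.simps(2))

text \<open>Completeness half: peel off the last arc, which the last pass relaxes against labels
  that already dominate the shorter walk.\<close>

lemma passes_ge_walk:
  "walk (set as) x p y \<Longrightarrow> length p \<le> k \<Longrightarrow> d x + gain p \<le> fst ((pass as ^^ k) (d, f)) y"
proof (induction k arbitrary: p y)
  case (Suc k)
  let ?d = "fst ((pass as ^^ k) (d, f))"
  show ?case
  proof (cases p rule: rev_cases)
    case Nil
    then have "d x + gain p \<le> ?d y" using Suc.IH[of p] Suc.prems by simp
    also have "\<dots> \<le> fst (fold relax as (?d, False)) y" by (rule fold_relax_mono)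
    finally show ?thesis unfolding passes_Suc .
  next
    case (snoc q a)
    obtain u v g where a: "a = (u, v, g)" by (cases a)
    have q: "walk (set as) x q u" "a \<in> set as" "v = y" "length q \<le> k"
      using Suc.prems by (auto simp: snoc walk_append a)
    have "d x + gain p \<le> ?d u + g" using Suc.IH[OF q(1,4)] by (simp add: snoc a)
    also have "\<dots> \<le> fst (fold relax as (?d, False)) y"
      using q a by (intro fold_relax_arc) auto
    finally show ?thesis unfolding passes_Suc .
  qed
qed simp

text \<open>The initial values \<open>d\<close> are arbitrary: they only weight the starting nodes of the walks.\<close>

theorem bellman_ford:
  assumes "\<And>a. a \<in> set as \<Longrightarrow> fst a < N" "N < k"
  shows "snd ((pass as ^^ k) (d, f)) \<longleftrightarrow> pos_cycle (set as)"
proof -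
  \<comment> \<open>Without a positive cycle the first \<open>j \<ge> N\<close> passes settle the
    labels; the one left over is the test.\<close>
  from assms(2) obtain j where k: "k = Suc j" and "N \<le> j" by (cases k) auto
  let ?d = "fst ((pass as ^^ j) (d, f))"
  \<comment> \<open>The walk behind the label of \<open>x\<close>, extended by the arc, is dominated
    by a walk with the same start and at most \<open>N\<close> arcs, and the \<open>j\<close> passes
    have accounted for that one.\<close>
  have "potential (set as) ?d" if no: "\<not> pos_cycle (set as)"
    unfolding potential_def
  proof clarify
    fix x y g assume a: "(x, y, g) \<in> set as"
    from walk_values_passes obtain z p where p: "walk (set as) z p x" "?d x = d z + gain p"
      unfolding walk_values_def by blast
    with a have "walk (set as) z (p @ [(x, y, g)]) y" by (auto simp: walk_append)
    then obtain q where q: "walk (set as) z q y" "gain (p @ [(x, y, g)]) \<le> gain q" "length q \<le> N"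
      using short_walk[OF no assms(1)] by blast
    with passes_ge_walk[OF q(1), of j d f] \<open>N \<le> j\<close> p show "?d x + g \<le> ?d y" by simp
  qed
  \<comment> \<open>A potential is a fixed point and keeps the flag down, and a flag that stays down
    exhibits a potential, which excludes positive cycles.\<close>
  then show ?thesis
    unfolding k passes_Suc
    by (metis fold_relax_potential fold_relax_unflagged potential_no_pos_cycle snd_conv)
qed

section \<open>The residual digraph\<close>

lemma sum_sum_list_swap:
  fixes h :: "'a \<Rightarrow> 'b \<Rightarrow> real"
  shows "(\<Sum>e\<in>F. \<Sum>a\<leftarrow>p. h e a) = (\<Sum>a\<leftarrow>p. \<Sum>e\<in>F. h e a)"
  by (induction p) (simp_all add: sum.distrib)

lemma sum_list_le_length:
  fixes f :: "'a \<Rightarrow> real" and u :: real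
  shows "(\<And>a. a \<in> set p \<Longrightarrow> f a \<le> u) \<Longrightarrow> (\<Sum>a\<leftarrow>p. f a) \<le> real (length p) * u"
  using sum_list_mono[of p f "\<lambda>_. u"] by (simp add: sum_list_triv)

lemma sum_list_ge_length:
  fixes f :: "'a \<Rightarrow> real" and u :: real
  shows "(\<And>a. a \<in> set p \<Longrightarrow> u \<le> f a) \<Longrightarrow> real (length p) * u \<le> (\<Sum>a\<leftarrow>p. f a)"
  using sum_list_mono[of p "\<lambda>_. u" f] by (simp add: sum_list_triv)

lemma sum_mult_point:
  fixes f :: "'a \<Rightarrow> real"
  assumes "finite F"
  shows "(\<Sum>e\<in>F. f e * of_bool (e = e0)) = (if e0 \<in> F then f e0 else 0)"
    "(\<Sum>e\<in>F. of_bool (e = e0) :: real) = of_bool (e0 \<in> F)"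
  using assms by (simp_all add: of_bool_def if_distrib sum.delta cong: if_cong)

locale matching_instance =
  fixes n :: nat and E :: "nat set set" and w :: "nat set \<Rightarrow> real" and c :: "nat \<Rightarrow> nat"
    and M :: "nat set set" and es :: "(nat \<times> nat) list"
  assumes graph: "simple_graph {..<n} E"
    and matching: "c_matching {..<n} E c M"
    and edges: "edge_list E es"
begin

definition deg :: "nat \<Rightarrow> nat" where
  "deg v = card {e \<in> M. v \<in> e}"

text \<open>Residual digraph of \<open>M\<close> in the bipartite double cover: \<open>v\<close> and \<open>n + v\<close> are the two copies of the
  vertex \<open>v\<close>, and \<open>n + n\<close> is source and sink identified.\<close>

definition edge_arcs :: "nat set \<Rightarrow> nat \<times> nat \<Rightarrow> arc list" where
  "edge_arcs U = (\<lambda>(u, v). if u \<in> U \<and> v \<in> U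
     then if {u, v} \<in> M then [(n + u, v, - w {u, v}), (n + v, u, - w {u, v})]
          else [(u, n + v, w {u, v}), (v, n + u, w {u, v})]
     else [])"

text \<open>The flow sends \<open>deg v\<close> units from the source to \<open>v\<close> and from
  \<open>n + v\<close> to the sink, each with capacity \<open>c v\<close>. Slack gives the forward
  residual arcs, positive flow the backward ones.\<close>

definition vertex_arcs :: "nat set \<Rightarrow> nat \<Rightarrow> arc list" where
  "vertex_arcs U v = (if v \<in> U
     then (if deg v < c v then [(n + n, v, 0), (n + v, n + n, 0)] else []) @
          (if 0 < deg v then [(v, n + n, 0), (n + n, n + v, 0)] else [])
     else [])"

definition arcs :: "nat set \<Rightarrow> arc list" where
  "arcs U = concat (map (edge_arcs U) es) @ concat (map (vertex_arcs U) [0..<n])"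

definition exposed :: "nat set" where
  "exposed = {v. v < n \<and> deg v = 0}"

definition optimal_on :: "nat set \<Rightarrow> bool" where
  "optimal_on U \<longleftrightarrow> (\<forall>x. fractional_c_matching U (induced_edges E U) c x \<longrightarrow>
     (\<Sum>e\<in>induced_edges E U. w e * x e) \<le> sum w M)"

lemma finite_E: "finite E"
  by (rule finite_subset[of _ "Pow {..<n}"]) (use graph in \<open>auto simp: simple_graph_def\<close>)

lemma matching_edges: "M \<subseteq> E"
  using matching unfolding c_matching_def by blast

lemma finite_M: "finite M"
  using matching_edges finite_E finite_subset by blast

lemma deg_le: "v < n \<Longrightarrow> deg v \<le> c v"
  using matching unfolding c_matching_def deg_def by auto

lemma deg_pos_iff: "0 < deg v \<longleftrightarrow> (\<exists>e\<in>M. v \<in> e)"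
  unfolding deg_def using finite_M by (auto simp: card_gt_0_iff)

lemma edge_endpoints:
  assumes "e \<in> E"
  obtains u v where "e = {u, v}" "u < n" "v < n" "u \<noteq> v"
  using assms graph unfolding simple_graph_def by (auto simp: card_2_iff)

lemma edge_vertices: "{u, v} \<in> E \<Longrightarrow> u < n \<and> v < n \<and> u \<noteq> v"
  by (metis doubleton_eq_iff edge_endpoints)

lemma matching_induced:
  assumes "S \<subseteq> exposed"
  shows "M \<subseteq> induced_edges E ({..<n} - S)"
proof
  fix e assume e: "e \<in> M"
  then have "e \<in> E" using matching_edges by blast
  then have "e \<subseteq> {..<n}" using graph unfolding simple_graph_def by blast
  moreover have "v \<notin> S" if "v \<in> e" for v
    using that e assms deg_pos_iff[of v] unfolding exposed_def by fastforce
  ultimately show "e \<in> induced_edges E ({..<n} - S)"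
    using \<open>e \<in> E\<close> unfolding induced_edges_def by blast
qed

lemma mem_es: "(u, v) \<in> set es \<Longrightarrow> {u, v} \<in> E"
  using edges unfolding edge_list_def by force

lemma edge_in_es: "{u, v} \<in> E \<Longrightarrow> (u, v) \<in> set es \<or> (v, u) \<in> set es"
  using edges unfolding edge_list_def by (fastforce simp: doubleton_eq_iff)

text \<open>Each listed edge yields arcs for both orientations, so ordered pairs \<open>u\<close>,
  \<open>v\<close> describe the arcs independently of how \<open>es\<close> orients the
  edges.\<close>

lemma mem_arcs:
  assumes "U \<subseteq> {..<n}"
  shows "a \<in> set (arcs U) \<longleftrightarrow>
     (\<exists>u v. u \<in> U \<and> v \<in> U \<and> {u, v} \<in> E - M \<and> a = (u, n + v, w {u, v})) \<or>
     (\<exists>u v. u \<in> U \<and> v \<in> U \<and> {u, v} \<in> M \<and> a = (n + u, v, - w {u, v})) \<or>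
     (\<exists>v\<in>U. deg v < c v \<and> (a = (n + n, v, 0) \<or> a = (n + v, n + n, 0))) \<or>
     (\<exists>v\<in>U. 0 < deg v \<and> (a = (v, n + n, 0) \<or> a = (n + n, n + v, 0)))"
    (is "_ \<longleftrightarrow> ?P \<or> ?Q \<or> ?R \<or> ?S")
proof -
  have "a \<in> (\<Union>e\<in>set es. set (edge_arcs U e)) \<longleftrightarrow> ?P \<or> ?Q"
  proof
    assume "a \<in> (\<Union>e\<in>set es. set (edge_arcs U e))"
    then obtain u v where *: "(u, v) \<in> set es" "a \<in> set (edge_arcs U (u, v))" by auto
    from *(1) have "{u, v} \<in> E" by (rule mem_es)
    moreover have "{u, v} = {v, u}" by blast
    ultimately show "?P \<or> ?Q" using *(2)
      unfolding edge_arcs_def by (auto split: if_splits)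
  next
    assume "?P \<or> ?Q"
    then obtain u v where *: "u \<in> U" "v \<in> U" "{u, v} \<in> E"
      "{u, v} \<notin> M \<and> a = (u, n + v, w {u, v}) \<or> {u, v} \<in> M \<and> a = (n + u, v, - w {u, v})"
      using matching_edges by blast
    have "a \<in> set (edge_arcs U (u, v))" "a \<in> set (edge_arcs U (v, u))"
      using * unfolding edge_arcs_def by (auto simp: insert_commute)
    with edge_in_es[OF *(3)] show "a \<in> (\<Union>e\<in>set es. set (edge_arcs U e))" by blast
  qed
  moreover have "a \<in> (\<Union>v\<in>set [0..<n]. set (vertex_arcs U v)) \<longleftrightarrow> ?R \<or> ?S"
    using assms unfolding vertex_arcs_def by (auto split: if_splits)
  ultimately show ?thesis unfolding arcs_def by auto
qed

lemma unmatched_arcs: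
  assumes "U \<subseteq> {..<n}" "{u, v} \<subseteq> U" "{u, v} \<in> E - M"
  shows "(u, n + v, w {u, v}) \<in> set (arcs U)" "(v, n + u, w {u, v}) \<in> set (arcs U)"
  unfolding mem_arcs[OF assms(1)] using assms(2,3) by (auto simp: insert_commute)

lemma matched_arcs:
  assumes "U \<subseteq> {..<n}" "{u, v} \<subseteq> U" "{u, v} \<in> M"
  shows "(n + u, v, - w {u, v}) \<in> set (arcs U)" "(n + v, u, - w {u, v}) \<in> set (arcs U)"
  unfolding mem_arcs[OF assms(1)] using assms(2,3) by (auto simp: insert_commute)

lemma arcs_mono: "U \<subseteq> U' \<Longrightarrow> U' \<subseteq> {..<n} \<Longrightarrow> set (arcs U) \<subseteq> set (arcs U')"
proof
  fix a assume U: "U \<subseteq> U'" "U' \<subseteq> {..<n}" and a: "a \<in> set (arcs U)"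
  then have "U \<subseteq> {..<n}" by blast
  from a U(1) show "a \<in> set (arcs U')" unfolding mem_arcs[OF U(2)] mem_arcs[OF \<open>U \<subseteq> {..<n}\<close>] by blast
qed

lemma arc_source: "U \<subseteq> {..<n} \<Longrightarrow> a \<in> set (arcs U) \<Longrightarrow> fst a < n + n + 1"
  by (subst (asm) mem_arcs) (auto simp: subset_iff)

text \<open>Indicator vectors of c-matchings are fractional c-matchings. If \<open>M\<close> attains
  the fractional optimum, it thus attains the integral one and both agree; conversely, stability
  carries the optimality of \<open>M\<close> over to \<open>nu_f\<close>. The edges of
  \<open>M\<close> survive the deletion exactly when \<open>S\<close> avoids their ends.\<close>

lemma M_vertex_stabilizer_iff:
  "M_vertex_stabilizer {..<n} E w c M S \<longleftrightarrow> S \<subseteq> exposed \<and> optimal_on ({..<n} - S)"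
proof -
  let ?U = "{..<n} - S"
  let ?F = "induced_edges E ?U"
  have finF: "finite ?F" unfolding induced_edges_def using finite_E by simp
  have ind: "fractional_c_matching ?U ?F c (\<lambda>e. of_bool (e \<in> N))"
      "(\<Sum>e\<in>?F. w e * of_bool (e \<in> N)) = sum w N" if "c_matching ?U ?F c N" for N
  proof -
    have N: "N \<subseteq> ?F" "\<forall>v\<in>?U. card {e \<in> N. v \<in> e} \<le> c v" using that unfolding c_matching_def by auto
    have "(\<Sum>e\<in>{e \<in> ?F. v \<in> e}. of_bool (e \<in> N) :: real) = card {e \<in> N. v \<in> e}" for v
    proof -
      have "{e \<in> ?F. v \<in> e} \<inter> N = {e \<in> N. v \<in> e}" using N(1) by blast
      then show ?thesis using finF by (simp add: sum.If_cases of_bool_def)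
    qed
    then show "fractional_c_matching ?U ?F c (\<lambda>e. of_bool (e \<in> N))"
      using N(2) unfolding fractional_c_matching_def by simp
    have "?F \<inter> N = N" using N(1) by blast
    then show "(\<Sum>e\<in>?F. w e * of_bool (e \<in> N)) = sum w N"
      using finF by (simp add: of_bool_def if_distrib sum.If_cases cong: if_cong)
  qed
  have fin: "finite {sum w N |N. c_matching ?U ?F c N}"
  proof (rule finite_subset)
    show "{sum w N |N. c_matching ?U ?F c N} \<subseteq> sum w ` Pow ?F" unfolding c_matching_def by blast
  qed (use finF in simp)
  \<comment> \<open>\<open>nu_f\<close> is a supremum of reals, which bounds its elements only if
    the set is bounded; \<open>0 \<le> x e \<le> 1\<close> provides this.\<close>
  have bdd: "bdd_above {\<Sum>e\<in>?F. w e * x e |x. fractional_c_matching ?U ?F c x}"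
  proof (rule bdd_aboveI)
    fix r assume "r \<in> {\<Sum>e\<in>?F. w e * x e |x. fractional_c_matching ?U ?F c x}"
    then obtain x where r: "r = (\<Sum>e\<in>?F. w e * x e)" and x: "\<forall>e\<in>?F. 0 \<le> x e \<and> x e \<le> 1"
      unfolding fractional_c_matching_def by blast
    show "r \<le> (\<Sum>e\<in>?F. \<bar>w e\<bar>)" unfolding r
    proof (rule sum_mono)
      fix e assume "e \<in> ?F"
      then have "\<bar>w e\<bar> * \<bar>x e\<bar> \<le> \<bar>w e\<bar> * 1" using x by (intro mult_left_mono) auto
      then show "w e * x e \<le> \<bar>w e\<bar>" by (metis abs_ge_self abs_mult mult.right_neutral order_trans)
    qed
  qed
  have nu_eq: "nu ?U ?F w c = sum w M" if "max_weight_c_matching ?U ?F w c M"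
    unfolding nu_def by (rule Max_eqI) (use fin that in \<open>auto simp: max_weight_c_matching_def\<close>)
  have cmM: "c_matching ?U ?F c M \<longleftrightarrow> M \<subseteq> ?F"
    using matching unfolding c_matching_def by auto
  have sub: "S \<subseteq> {..<n} \<and> M \<subseteq> ?F \<longleftrightarrow> S \<subseteq> exposed"
  proof
    assume "S \<subseteq> {..<n} \<and> M \<subseteq> ?F"
    then show "S \<subseteq> exposed" using deg_pos_iff unfolding exposed_def induced_edges_def by fastforce
  next
    assume S: "S \<subseteq> exposed"
    then have "M \<subseteq> ?F" by (rule matching_induced)
    with S show "S \<subseteq> {..<n} \<and> M \<subseteq> ?F" unfolding exposed_def by blast
  qed
  show ?thesis
  proof
    assume "M_vertex_stabilizer {..<n} E w c M S"
    then have S: "S \<subseteq> {..<n}" "nu ?U ?F w c = nu_f ?U ?F w c" and mw: "max_weight_c_matching ?U ?F w c M"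
      unfolding M_vertex_stabilizer_def stable_def by auto
    have "M \<subseteq> ?F" using mw cmM unfolding max_weight_c_matching_def by blast
    have "optimal_on ?U" unfolding optimal_on_def
    proof (intro allI impI)
      fix x assume "fractional_c_matching ?U ?F c x"
      then have "(\<Sum>e\<in>?F. w e * x e) \<le> nu_f ?U ?F w c"
        unfolding nu_f_def by (intro cSup_upper bdd) blast
      then show "(\<Sum>e\<in>?F. w e * x e) \<le> sum w M" using S nu_eq[OF mw] by simp
    qed
    with S \<open>M \<subseteq> ?F\<close> sub show "S \<subseteq> exposed \<and> optimal_on ?U" by blast
  next
    assume A: "S \<subseteq> exposed \<and> optimal_on ?U"
    then have M: "c_matching ?U ?F c M" "S \<subseteq> {..<n}" using sub cmM by auto
    have opt: "(\<Sum>e\<in>?F. w e * x e) \<le> sum w M" if "fractional_c_matching ?U ?F c x" for x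
      using A that unfolding optimal_on_def by blast
    have mw: "max_weight_c_matching ?U ?F w c M"
      unfolding max_weight_c_matching_def
    proof (intro conjI allI impI M)
      fix N assume "c_matching ?U ?F c N"
      from opt[OF ind(1)[OF this]] ind(2)[OF this] show "sum w N \<le> sum w M" by simp
    qed
    have "nu_f ?U ?F w c = sum w M" unfolding nu_f_def
    proof (rule cSup_eq_maximum)
      show "sum w M \<in> {\<Sum>e\<in>?F. w e * x e |x. fractional_c_matching ?U ?F c x}"
        using ind[OF M(1)] by (intro CollectI exI[of _ "\<lambda>e. of_bool (e \<in> M)"]) simp
    next
      fix r assume "r \<in> {\<Sum>e\<in>?F. w e * x e |x. fractional_c_matching ?U ?F c x}"
      then show "r \<le> sum w M" using opt by auto
    qed
    with nu_eq[OF mw] mw M show "M_vertex_stabilizer {..<n} E w c M S"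
      unfolding M_vertex_stabilizer_def stable_def by simp
  qed
qed

section \<open>Duality for the fractional matching program\<close>

lemma sum_over_edges:
  fixes y :: "nat \<Rightarrow> real" and x :: "nat set \<Rightarrow> real"
  assumes "finite U" "finite F" "\<And>e. e \<in> F \<Longrightarrow> e \<subseteq> U"
  shows "(\<Sum>e\<in>F. sum y e * x e) = (\<Sum>v\<in>U. y v * (\<Sum>e\<in>{e \<in> F. v \<in> e}. x e))"
proof -
  have "(\<Sum>e\<in>F. sum y e * x e) = (\<Sum>e\<in>F. \<Sum>v\<in>{v \<in> U. v \<in> e}. y v * x e)"
  proof (rule sum.cong[OF refl])
    fix e assume "e \<in> F"
    then have "{v \<in> U. v \<in> e} = e" using assms(3) by blast
    then show "sum y e * x e = (\<Sum>v\<in>{v \<in> U. v \<in> e}. y v * x e)" by (simp add: sum_distrib_right)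
  qed
  also have "\<dots> = (\<Sum>v\<in>U. \<Sum>e\<in>{e \<in> F. v \<in> e}. y v * x e)"
    by (rule sum.swap_restrict[OF assms(2,1)])
  finally show ?thesis by (simp add: sum_distrib_left)
qed

text \<open>Weak duality with complementary slackness. The dual variable of
  \<open>x e \<le> 1\<close> is left implicit: it is \<open>w e - sum y e\<close> on
  \<open>M\<close> and 0 elsewhere.\<close>

lemma optimal_if_dual:
  assumes U: "U \<subseteq> {..<n}" "M \<subseteq> induced_edges E U"
    and y: "\<And>v. v \<in> U \<Longrightarrow> 0 \<le> y v" "\<And>v. v \<in> U \<Longrightarrow> 0 < y v \<Longrightarrow> deg v = c v"
    and cover: "\<And>e. e \<in> induced_edges E U \<Longrightarrow> e \<notin> M \<Longrightarrow> w e \<le> sum y e"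
    and tight: "\<And>e. e \<in> M \<Longrightarrow> sum y e \<le> w e"
  shows "optimal_on U"
  unfolding optimal_on_def
proof (intro allI impI)
  fix x assume x: "fractional_c_matching U (induced_edges E U) c x"
  let ?F = "induced_edges E U"
  have F: "finite ?F" "\<And>e. e \<in> ?F \<Longrightarrow> e \<subseteq> U" unfolding induced_edges_def using finite_E by auto
  have fU: "finite U" using U(1) finite_subset by blast
  have "(\<Sum>e\<in>?F. w e * x e) \<le> (\<Sum>e\<in>?F. sum y e * x e + (if e \<in> M then w e - sum y e else 0))"
  proof (rule sum_mono)
    fix e assume e: "e \<in> ?F"
    then have xe: "0 \<le> x e" "x e \<le> 1" using x unfolding fractional_c_matching_def by auto
    show "w e * x e \<le> sum y e * x e + (if e \<in> M then w e - sum y e else 0)"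
    proof (cases "e \<in> M")
      case True
      have "(w e - sum y e) * x e \<le> (w e - sum y e) * 1"
        using tight[OF True] xe by (intro mult_left_mono) auto
      then show ?thesis using True by (simp add: algebra_simps)
    next
      case False
      then show ?thesis using cover[OF e] xe by (simp add: mult_right_mono)
    qed
  qed
  also have "\<dots> = (\<Sum>v\<in>U. y v * (\<Sum>e\<in>{e \<in> ?F. v \<in> e}. x e)) + (\<Sum>e\<in>M. w e - sum y e)"
  proof -
    have "?F \<inter> M = M" using U(2) by blast
    then show ?thesis using F fU sum_over_edges[OF fU F, of y x] by (simp add: sum.distrib sum.If_cases)
  qed
  also have "\<dots> \<le> (\<Sum>v\<in>U. y v * real (c v)) + (\<Sum>e\<in>M. w e - sum y e)"
    using x y(1) unfolding fractional_c_matching_def by (intro add_right_mono sum_mono mult_left_mono) auto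
  \<comment> \<open>Slackness replaces \<open>c v\<close> by the degree in \<open>M\<close>;
    counting the incidences back over the edges then cancels the \<open>y\<close> terms.\<close>
  also have "(\<Sum>v\<in>U. y v * real (c v)) = (\<Sum>v\<in>U. y v * (\<Sum>e\<in>{e \<in> M. v \<in> e}. 1))"
  proof (rule sum.cong[OF refl])
    fix v assume "v \<in> U"
    then show "y v * real (c v) = y v * (\<Sum>e\<in>{e \<in> M. v \<in> e}. 1)"
      using y[of v] by (cases "y v = 0") (auto simp: deg_def)
  qed
  also have "\<dots> = (\<Sum>e\<in>M. sum y e * 1)"
    by (rule sum_over_edges[symmetric]) (use fU finite_M U F in auto)
  finally show "(\<Sum>e\<in>?F. w e * x e) \<le> sum w M" by (simp add: sum_subtractf)
qed

lemma optimal_if_no_pos_cycle: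
  assumes U: "U \<subseteq> {..<n}" "M \<subseteq> induced_edges E U" and no: "\<not> pos_cycle (set (arcs U))"
  shows "optimal_on U"
proof -
  \<comment> \<open>There are \<open>n + n + 1\<close> nodes, and one more pass is the test. If it
    raises no flag, its labels are a potential.\<close>
  let ?k = "n + n + 2"
  obtain d where d: "potential (set (arcs U)) d"
  proof -
    have "\<not> snd ((pass (arcs U) ^^ ?k) (\<lambda>_. 0, False))"
      using bellman_ford[OF arc_source[OF U(1)], of "arcs U" ?k "\<lambda>_. 0" False] no by simp
    moreover have k: "?k = Suc (n + n + 1)" by simp
    ultimately show thesis unfolding k passes_Suc by (blast dest: fold_relax_unflagged intro: that)
  qed
  have arc: "d x + g \<le> d z" if "(x, z, g) \<in> set (arcs U)" for x z g
    using d that unfolding potential_def by blast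
  \<comment> \<open>Adding the inequalities of the two orientations of an edge gives its dual
    constraint for \<open>q\<close>. Root arcs fix the sign: \<open>q v \<le> 0\<close> at
    unsaturated vertices, \<open>q v \<ge> 0\<close> at vertices met by \<open>M\<close>. Cutting at
    0 hence leaves \<open>q\<close> alone on matched edges and only helps to cover the
    others.\<close>
  define q where "q v = (d (n + v) - d v) / 2" for v
  define y where "y v = max 0 (q v)" for v
  show ?thesis
  proof (rule optimal_if_dual[OF U])
    show "0 \<le> y v" for v by (simp add: y_def)
    show "deg v = c v" if "v \<in> U" "0 < y v" for v
    proof (rule ccontr)
      assume "deg v \<noteq> c v"
      then have "deg v < c v" using deg_le[of v] that U(1) by auto
      then have "(n + n, v, 0) \<in> set (arcs U)" "(n + v, n + n, 0) \<in> set (arcs U)"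
        unfolding mem_arcs[OF U(1)] using that(1) by blast+
      from this[THEN arc] show False using that(2) by (auto simp: y_def q_def)
    qed
    fix e
    {
      assume e: "e \<in> induced_edges E U" "e \<notin> M"
      then obtain u v where uv: "e = {u, v}" "u \<noteq> v" using edge_endpoints unfolding induced_edges_def by blast
      have "(u, n + v, w e) \<in> set (arcs U)" "(v, n + u, w e) \<in> set (arcs U)"
        using unmatched_arcs[OF U(1), of u v] e uv unfolding induced_edges_def by auto
      from this[THEN arc] have "w e \<le> q u + q v" by (simp add: q_def field_simps)
      also have "\<dots> \<le> y u + y v" by (simp add: y_def)
      finally show "w e \<le> sum y e" using uv by simp
    next
      assume e: "e \<in> M"
      then have eU: "e \<in> E" "e \<subseteq> U" using U(2) unfolding induced_edges_def by auto
      then obtain u v where uv: "e = {u, v}" "u \<noteq> v" using edge_endpoints by blast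
      have "0 \<le> q z" if "z \<in> e" for z
      proof -
        have "0 < deg z" using that e deg_pos_iff by blast
        then have "(z, n + n, 0) \<in> set (arcs U)" "(n + n, n + z, 0) \<in> set (arcs U)"
          unfolding mem_arcs[OF U(1)] using that eU by blast+
        from this[THEN arc] show ?thesis by (simp add: q_def)
      qed
      then have "y u = q u" "y v = q v" using uv by (auto simp: y_def)
      moreover have "(n + u, v, - w e) \<in> set (arcs U)" "(n + v, u, - w e) \<in> set (arcs U)"
        using matched_arcs[OF U(1), of u v] e uv eU by auto
      from this[THEN arc] have "q u + q v \<le> w e" by (simp add: q_def field_simps)
      ultimately show "sum y e \<le> w e" using uv by simp
    }
  qed
qed

text \<open>The change of the edge \<open>e\<close> when one unit is sent along a residual arc.\<close>

definition edge_change :: "nat set \<Rightarrow> arc \<Rightarrow> real" where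
  "edge_change e = (\<lambda>(x, y, g).
     if x < n \<and> n \<le> y \<and> y < n + n then of_bool (e = {x, y - n})
     else if n \<le> x \<and> x < n + n \<and> y < n then - of_bool (e = {x - n, y})
     else 0)"

definition degree_change :: "nat set \<Rightarrow> arc \<Rightarrow> nat \<Rightarrow> real" where
  "degree_change U a v = (\<Sum>e\<in>{e \<in> induced_edges E U. v \<in> e}. edge_change e a)"

section \<open>Effect of a residual arc on edges and degrees\<close>

context
  fixes U a
  assumes U: "U \<subseteq> {..<n}" "M \<subseteq> induced_edges E U" and a: "a \<in> set (arcs U)"
begin

lemma residual_arc_cases [case_names unmatched matched slack loaded]:
  obtains u v where "{u, v} \<in> induced_edges E U - M" "u < n" "v < n" "u \<noteq> v" "a = (u, n + v, w {u, v})"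
      "\<And>e. edge_change e a = of_bool (e = {u, v})"
  | u v where "{u, v} \<in> M" "u < n" "v < n" "u \<noteq> v" "a = (n + u, v, - w {u, v})"
      "\<And>e. edge_change e a = - of_bool (e = {u, v})"
  | u where "u < n" "deg u < c u" "a = (n + n, u, 0) \<or> a = (n + u, n + n, 0)" "\<And>e. edge_change e a = 0"
  | u where "u < n" "a = (u, n + n, 0) \<or> a = (n + n, n + u, 0)" "\<And>e. edge_change e a = 0"
proof -
  from a[unfolded mem_arcs[OF U(1)]] consider
    (1) u v where "u \<in> U" "v \<in> U" "{u, v} \<in> E - M" "a = (u, n + v, w {u, v})"
    | (2) u v where "u \<in> U" "v \<in> U" "{u, v} \<in> M" "a = (n + u, v, - w {u, v})"
    | (3) v where "v \<in> U" "deg v < c v" "a = (n + n, v, 0) \<or> a = (n + v, n + n, 0)"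
    | (4) v where "v \<in> U" "a = (v, n + n, 0) \<or> a = (n + n, n + v, 0)"
    by blast
  then show thesis
  proof cases
    case 1
    then show thesis using edge_vertices[of u v] that(1)[of u v]
      by (auto simp: edge_change_def induced_edges_def)
  next
    case 2
    then show thesis using edge_vertices[of u v] matching_edges that(2)[of u v]
      by (auto simp: edge_change_def)
  next
    case 3
    then show thesis using U(1) that(3)[of v] by (auto simp: edge_change_def)
  next
    case 4
    then show thesis using U(1) that(4)[of v] by (auto simp: edge_change_def)
  qed
qed

lemma edge_change_bounds:
  "e \<notin> M \<Longrightarrow> 0 \<le> edge_change e a" "e \<in> M \<Longrightarrow> edge_change e a \<le> 0" "\<bar>edge_change e a\<bar> \<le> 1"
  by (cases rule: residual_arc_cases; auto)+

lemma finite_induced: "finite (induced_edges E U)"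
  unfolding induced_edges_def using finite_E by simp

text \<open>Root arcs have gain 0 and change no edge; any other arc carries the signed weight of the
  one edge it changes.\<close>

lemma sum_edge_change_weight: "(\<Sum>e\<in>induced_edges E U. w e * edge_change e a) = snd (snd a)"
proof (cases rule: residual_arc_cases)
  case (unmatched u v)
  then show ?thesis unfolding unmatched(6) sum_mult_point(1)[OF finite_induced] by simp
next
  case (matched u v)
  have "(\<Sum>e\<in>induced_edges E U. w e * edge_change e a) =
      - (\<Sum>e\<in>induced_edges E U. w e * of_bool (e = {u, v}))"
    unfolding matched(6) by (simp add: sum_negf)
  then show ?thesis unfolding sum_mult_point(1)[OF finite_induced] using matched U(2) by auto
qed auto

lemma degree_change_cases [case_names unmatched matched slack loaded]:
  obtains u v where "a = (u, n + v, w {u, v})" "u < n" "v < n" "u \<noteq> v"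
      "\<And>z. degree_change U a z = of_bool (z = u \<or> z = v)"
  | u v where "a = (n + u, v, - w {u, v})" "u < n" "v < n" "u \<noteq> v"
      "\<And>z. degree_change U a z = - of_bool (z = u \<or> z = v)"
  | u where "u < n" "deg u < c u" "a = (n + n, u, 0) \<or> a = (n + u, n + n, 0)"
      "\<And>z. degree_change U a z = 0"
  | u where "u < n" "a = (u, n + n, 0) \<or> a = (n + n, n + u, 0)"
      "\<And>z. degree_change U a z = 0"
proof (cases rule: residual_arc_cases)
  case (unmatched u v)
  have "degree_change U a z = of_bool (z = u \<or> z = v)" for z
    unfolding degree_change_def unmatched(6) using finite_induced unmatched(1)
    by (subst sum_mult_point(2)) auto
  then show thesis using unmatched that(1) by blast
next
  case (matched u v)
  have "degree_change U a z = - of_bool (z = u \<or> z = v)" for z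
    unfolding degree_change_def matched(6) sum_negf using finite_induced matched(1) U(2)
    by (subst sum_mult_point(2)) auto
  then show thesis using matched that(2) by blast
next
  case (slack u)
  then show thesis using that(3)[of u] by (simp add: degree_change_def)
next
  case (loaded u)
  then show thesis using that(4)[of u] by (simp add: degree_change_def)
qed

lemma degree_change_le_1: "degree_change U a v \<le> 1"
  by (cases rule: degree_change_cases) auto

text \<open>The right side is the increase along the arc of the function that is 1 at
  \<open>n + v\<close>, -1 at \<open>v\<close> and 0 elsewhere, so it telescopes to 0 on a closed
  walk. Edge arcs give equality. Slack arcs at \<open>v\<close> would give -1 on the right, but a
  saturated vertex has none; loaded arcs at \<open>v\<close> give 0 \<le> 1.\<close>

lemma degree_change_le_flow:
  assumes "v < n" "deg v = c v"
  shows "degree_change U a v \<le> (of_bool (fst (snd a) = n + v) - of_bool (fst (snd a) = v))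
     - (of_bool (fst a = n + v) - of_bool (fst a = v))"
  by (cases rule: degree_change_cases) (use assms in \<open>auto simp: of_bool_def\<close>)

end

lemma no_pos_cycle_if_optimal:
  assumes U: "U \<subseteq> {..<n}" "M \<subseteq> induced_edges E U" and opt: "optimal_on U"
  shows "\<not> pos_cycle (set (arcs U))"
proof
  assume "pos_cycle (set (arcs U))"
  then obtain z p where p: "walk (set (arcs U)) z p z" "0 < gain p" unfolding pos_cycle_def by blast
  let ?F = "induced_edges E U"
  \<comment> \<open>The walk may repeat arcs. Each arc changes an edge by at most 1, downwards on
    \<open>M\<close> and upwards elsewhere, so dividing by the length keeps every value between 0
    and 1.\<close>
  define l :: real where "l = length p"
  have l: "0 < l" using p(2) unfolding l_def by (cases p) auto
  have in_arcs: "a \<in> set (arcs U)" if "a \<in> set p" for a using walk_arcs[OF p(1)] that by blast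
  have F: "finite ?F" unfolding induced_edges_def using finite_E by simp
  define X where "X e = (\<Sum>a\<leftarrow>p. edge_change e a)" for e
  define x where "x e = of_bool (e \<in> M) + X e / l" for e
  have X_le: "X e \<le> l" for e
    unfolding X_def l_def using sum_list_le_length[of p "edge_change e" 1] edge_change_bounds(3)[OF U in_arcs]
    by (force simp: abs_le_iff)
  have X_ge: "- l \<le> X e" for e
    unfolding X_def l_def using sum_list_ge_length[of p "-1" "edge_change e"] edge_change_bounds(3)[OF U in_arcs]
    by (force simp: abs_le_iff)
  have x01: "0 \<le> x e \<and> x e \<le> 1" for e
  proof (cases "e \<in> M")
    case True
    have "X e \<le> 0" unfolding X_def
      using sum_list_le_length[of p "edge_change e" 0] edge_change_bounds(2)[OF U in_arcs True] by simp
    then show ?thesis using True X_ge[of e] l by (simp add: x_def field_simps)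
  next
    case False
    have "0 \<le> X e" unfolding X_def
      using edge_change_bounds(1)[OF U in_arcs False] by (intro sum_list_nonneg) auto
    then show ?thesis using False X_le[of e] l by (simp add: x_def)
  qed
  have feas: "(\<Sum>e\<in>{e \<in> ?F. v \<in> e}. x e) \<le> real (c v)" if "v \<in> U" for v
  proof -
    have v: "v < n" using that U by blast
    have "{e \<in> ?F. v \<in> e} \<inter> M = {e \<in> M. v \<in> e}" using U(2) by blast
    then have "(\<Sum>e\<in>{e \<in> ?F. v \<in> e}. of_bool (e \<in> M)) = real (deg v)"
      using F by (simp add: of_bool_def sum.If_cases deg_def)
    moreover have "(\<Sum>e\<in>{e \<in> ?F. v \<in> e}. X e) = (\<Sum>a\<leftarrow>p. degree_change U a v)"
      unfolding X_def sum_sum_list_swap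
      by (intro arg_cong[of _ _ sum_list] map_cong refl degree_change_def[symmetric])
    ultimately have sum_x: "(\<Sum>e\<in>{e \<in> ?F. v \<in> e}. x e) = real (deg v) + (\<Sum>a\<leftarrow>p. degree_change U a v) / l"
      by (simp add: x_def sum.distrib sum_divide_distrib[symmetric])
    show ?thesis
    \<comment> \<open>A saturated vertex must not gain, by the telescoping bound. An unsaturated one
      has room for a full unit, and its scaled gain is at most 1.\<close>
    proof (cases "deg v = c v")
      case True
      have "(\<Sum>a\<leftarrow>p. degree_change U a v) \<le> (\<Sum>a\<leftarrow>p. (of_bool (fst (snd a) = n + v) - of_bool (fst (snd a) = v))
     - (of_bool (fst a = n + v) - of_bool (fst a = v)))"
        by (intro sum_list_mono degree_change_le_flow[OF U in_arcs v True])
      also have "\<dots> = 0"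
        using walk_telescope[OF p(1), of "\<lambda>y. of_bool (y = n + v) - of_bool (y = v)"] by simp
      finally show ?thesis unfolding sum_x using True l by (simp add: divide_le_0_iff)
    next
      case False
      have "(\<Sum>a\<leftarrow>p. degree_change U a v) \<le> l"
        using sum_list_le_length[of p "\<lambda>a. degree_change U a v" 1] degree_change_le_1[OF U in_arcs]
        unfolding l_def by simp
      then have "(\<Sum>a\<leftarrow>p. degree_change U a v) / l \<le> 1" using l by simp
      then show ?thesis unfolding sum_x using False deg_le[OF v] by simp
    qed
  qed
  have "fractional_c_matching U ?F c x" unfolding fractional_c_matching_def using feas x01 by blast
  then have "(\<Sum>e\<in>?F. w e * x e) \<le> sum w M" using opt unfolding optimal_on_def by blast
  moreover have "(\<Sum>e\<in>?F. w e * x e) = sum w M + gain p / l"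
  proof -
    have "?F \<inter> M = M" using U(2) by blast
    then have "(\<Sum>e\<in>?F. w e * of_bool (e \<in> M)) = sum w M"
      using F by (simp add: of_bool_def if_distrib sum.If_cases cong: if_cong)
    moreover have "(\<Sum>e\<in>?F. w e * X e) = (\<Sum>a\<leftarrow>p. \<Sum>e\<in>?F. w e * edge_change e a)"
      unfolding X_def sum_list_const_mult[symmetric] by (rule sum_sum_list_swap)
    moreover have "\<dots> = gain p" unfolding gain_def
      by (intro arg_cong[of _ _ sum_list] map_cong refl sum_edge_change_weight[OF U in_arcs])
    ultimately show ?thesis
      by (simp add: x_def distrib_left sum.distrib sum_divide_distrib[symmetric])
  qed
  moreover have "0 < gain p / l" using p(2) l by simp
  ultimately show False by simp
qed

text \<open>The number \<open>n\<close> is no vertex and encodes the absence of a choice: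
  \<open>active n n\<close> contains no exposed vertex.\<close>

definition active :: "nat \<Rightarrow> nat \<Rightarrow> nat set" where
  "active a b = {v. v < n \<and> (0 < deg v \<or> v = a \<or> v = b)}"

lemma active_subset: "active a b \<subseteq> {..<n}"
  unfolding active_def by auto

text \<open>An exposed vertex \<open>v\<close> can be entered at \<open>v\<close> only from the root and left at \<open>n + v\<close> only to the
  root, and a simple cycle passes through the root at most once.\<close>

lemma pos_cycle_local:
  assumes U: "U \<subseteq> {..<n}" and pos: "pos_cycle (set (arcs U))"
    and none: "\<not> pos_cycle (set (arcs (active n n)))"
  obtains a b where "a \<in> U \<inter> exposed" "b \<in> U \<inter> exposed" "pos_cycle (set (arcs (active a b)))"
proof -
  from pos_cycle_distinct[OF pos] obtain z p where
    p: "walk (set (arcs U)) z p z" "0 < gain p" "distinct (map fst p)" .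
  have endpoints: "mset (map (fst \<circ> snd) p) = mset (map fst p)" using walk_endpoints[OF p(1)] by simp
  \<comment> \<open>Distinct targets mean that \<open>p\<close> also enters every node at most
    once.\<close>
  then have dist2: "distinct (map (fst \<circ> snd) p)" using p(3) by (metis mset_eq_imp_distinct_iff)
  from endpoints have set_eq: "fst ` snd ` set p = fst ` set p"
    by (metis image_comp list.set_map mset_eq_setD)
  define In where "In = {v \<in> exposed. (n + n, v, 0) \<in> set p}"
  define Out where "Out = {v \<in> exposed. (n + v, n + n, 0) \<in> set p}"
  \<comment> \<open>Two members of \<open>In\<close> would give two arcs leaving the root, two
    members of \<open>Out\<close> two arcs entering it.\<close>
  have In: "v = v'" if "v \<in> In" "v' \<in> In" for v v'
    using that p(3) unfolding In_def distinct_map inj_on_def by fastforce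
  have Out: "v = v'" if "v \<in> Out" "v' \<in> Out" for v v'
    using that dist2 unfolding Out_def distinct_map inj_on_def by fastforce
  have sub: "set p \<subseteq> set (arcs U)" by (rule walk_arcs[OF p(1)])
  \<comment> \<open>A closed walk that leaves \<open>v\<close> also enters it. No matched arc ends
    at an exposed \<open>v\<close>, so it comes from the root.\<close>
  have enter: "v \<in> In" if "v \<in> exposed" "v \<in> fst ` set p" for v
  proof -
    from that(2) set_eq obtain x g where a: "(x, v, g) \<in> set p" by force
    then have "(x, v, g) \<in> set (arcs U)" using sub by blast
    moreover have "v < n" "deg v = 0" using that unfolding exposed_def by auto
    ultimately have "x = n + n \<and> g = 0"
      unfolding mem_arcs[OF U] using U deg_pos_iff[of v] by auto
    with a that show ?thesis unfolding In_def by simp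
  qed
  have leave: "v \<in> Out" if "v \<in> exposed" "n + v \<in> fst ` snd ` set p" for v
  proof -
    from that(2) set_eq obtain y g where a: "(n + v, y, g) \<in> set p" by force
    then have "(n + v, y, g) \<in> set (arcs U)" using sub by blast
    moreover have "v < n" "deg v = 0" using that unfolding exposed_def by auto
    ultimately have "y = n + n \<and> g = 0"
      unfolding mem_arcs[OF U] using U deg_pos_iff[of v] by auto
    with a that show ?thesis unfolding Out_def by simp
  qed
  \<comment> \<open>An exposed end of an edge arc of \<open>p\<close> occurs as a source
    \<open>u\<close> or a target \<open>n + v\<close>, hence belongs to \<open>In\<close> or
    \<open>Out\<close>.\<close>
  have key: "set p \<subseteq> set (arcs (active a b))" if "In \<union> Out \<subseteq> {a, b}" for a b
  proof
    fix e assume e: "e \<in> set p"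
    have act: "v \<in> active a b" if "v \<in> U" "v \<in> exposed \<Longrightarrow> v \<in> In \<union> Out" for v
      using that \<open>In \<union> Out \<subseteq> {a, b}\<close> U unfolding active_def exposed_def by fastforce
    from e sub have "e \<in> set (arcs U)" by blast
    then consider
      (1) u v where "u \<in> U" "v \<in> U" "{u, v} \<in> E - M" "e = (u, n + v, w {u, v})"
      | (2) u v where "u \<in> U" "v \<in> U" "{u, v} \<in> M" "e = (n + u, v, - w {u, v})"
      | (3) v where "v \<in> U" "deg v < c v" "e = (n + n, v, 0) \<or> e = (n + v, n + n, 0)"
      | (4) v where "v \<in> U" "0 < deg v" "e = (v, n + n, 0) \<or> e = (n + n, n + v, 0)"
      unfolding mem_arcs[OF U] by blast
    then show "e \<in> set (arcs (active a b))"
    proof cases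
      case 1
      have "u \<in> active a b" by (rule act) (use 1 e enter in force)+
      moreover have "v \<in> active a b" by (rule act) (use 1 e leave in force)+
      ultimately show ?thesis unfolding mem_arcs[OF active_subset] using 1 by blast
    next
      case 2
      then have "0 < deg u" "0 < deg v" using deg_pos_iff by blast+
      with 2 have "u \<in> active a b" "v \<in> active a b" using U unfolding active_def by auto
      then show ?thesis unfolding mem_arcs[OF active_subset] using 2 by blast
    next
      case 3
      have "v \<in> active a b" by (rule act) (use 3 e in \<open>auto simp: In_def Out_def\<close>)
      then show ?thesis unfolding mem_arcs[OF active_subset] using 3 by blast
    next
      case 4
      then have "v \<in> active a b" using U unfolding active_def by auto
      then show ?thesis unfolding mem_arcs[OF active_subset] using 4 by blast
    qed
  qed
  have pc: "pos_cycle (set (arcs (active a b)))" if "In \<union> Out \<subseteq> {a, b}" for a b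
    using walk_mono[OF p(1) key[OF that]] p(2) unfolding pos_cycle_def by blast
  have inU: "v \<in> U \<inter> exposed" if "v \<in> In \<union> Out" for v
  proof -
    have v: "v \<in> exposed" "(n + n, v, 0) \<in> set (arcs U) \<or> (n + v, n + n, 0) \<in> set (arcs U)"
      using that sub unfolding In_def Out_def by auto
    then have "v < n" "deg v = 0" unfolding exposed_def by auto
    with v show ?thesis unfolding mem_arcs[OF U] using U by auto
  qed
  \<comment> \<open>Otherwise \<open>p\<close> would already live on
    \<open>active n n\<close>.\<close>
  have "In \<union> Out \<noteq> {}" using pc[of n n] none by auto
  then obtain a b where "a \<in> In \<union> Out" "b \<in> In \<union> Out" "In \<union> Out \<subseteq> {a, b}"
  proof -
    assume *: "In \<union> Out \<noteq> {}"
    show thesis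
    proof (cases "In = {} \<or> Out = {}")
      case True
      with * obtain v where "v \<in> In \<union> Out" by blast
      then show thesis using that[of v v] True In Out by blast
    next
      case False
      then obtain v v' where "v \<in> In" "v' \<in> Out" by blast
      then show thesis using that[of v v'] In Out by blast
    qed
  qed
  then show thesis using that pc inU by blast
qed

section \<open>Stabilizers as sets meeting all bad pairs\<close>

abbreviation stabilizer :: "nat set \<Rightarrow> bool" where
  "stabilizer S \<equiv> M_vertex_stabilizer {..<n} E w c M S"

lemma stabilizer_iff:
  "stabilizer S \<longleftrightarrow> S \<subseteq> exposed \<and> \<not> pos_cycle (set (arcs ({..<n} - S)))"
proof (cases "S \<subseteq> exposed")
  case True
  from True have "M \<subseteq> induced_edges E ({..<n} - S)" by (rule matching_induced)
  from optimal_if_no_pos_cycle[OF _ this] no_pos_cycle_if_optimal[OF _ this] True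
  show ?thesis unfolding M_vertex_stabilizer_iff by blast
qed (simp add: M_vertex_stabilizer_iff)

text \<open>A stabilizer deletes exposed vertices only, so all of \<open>active a b\<close>
  survives. Hence every stabilizer meets a bad pair, and \<open>a = b = n\<close> yields the
  infeasibility test.\<close>

lemma stabilizer_active:
  assumes "stabilizer S" "a \<notin> S" "b \<notin> S"
  shows "\<not> pos_cycle (set (arcs (active a b)))"
proof -
  have "active a b \<subseteq> {..<n} - S"
    using assms unfolding stabilizer_iff active_def exposed_def by auto
  then have "set (arcs (active a b)) \<subseteq> set (arcs ({..<n} - S))" by (rule arcs_mono) blast
  then show ?thesis using assms(1) pos_cycle_mono unfolding stabilizer_iff by blast
qed

lemma stabilizer_if_pairs:
  assumes "\<not> pos_cycle (set (arcs (active n n)))" "S \<subseteq> exposed"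
    and "\<And>a b. a \<in> exposed - S \<Longrightarrow> b \<in> exposed - S \<Longrightarrow> \<not> pos_cycle (set (arcs (active a b)))"
  shows "stabilizer S"
  unfolding stabilizer_iff
proof (intro conjI notI assms(2))
  assume "pos_cycle (set (arcs ({..<n} - S)))"
  from pos_cycle_local[OF _ this assms(1)] obtain a b
    where "a \<in> ({..<n} - S) \<inter> exposed" "b \<in> ({..<n} - S) \<inter> exposed"
      "pos_cycle (set (arcs (active a b)))" by blast
  then show False using assms(3) by blast
qed

end

section \<open>Programs with bounded loops\<close>

text \<open>An upper bound on the running time when every loop is iterated at most \<open>L\<close> times.\<close>

fun cost_bound :: "nat \<Rightarrow> com \<Rightarrow> nat" where
  "cost_bound L Skip = 1"
| "cost_bound L (NStore a b) = 1 + ncost a + ncost b"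
| "cost_bound L (RStore a b) = 1 + ncost a + rcost b"
| "cost_bound L (Seq P Q) = cost_bound L P + cost_bound L Q"
| "cost_bound L (Cond b P Q) = 1 + bcost b + cost_bound L P + cost_bound L Q"
| "cost_bound L (While b P) = (L + 1) * (1 + bcost b + cost_bound L P)"

lemma cost_bound_poly: "\<exists>p :: nat poly. \<forall>L. cost_bound L P = poly p L"
proof (induction P)
  case Skip
  show ?case by (intro exI[of _ "[:1:]"]) simp
next
  case (NStore a b)
  show ?case by (intro exI[of _ "[:1 + ncost a + ncost b:]"]) simp
next
  case (RStore a b)
  show ?case by (intro exI[of _ "[:1 + ncost a + rcost b:]"]) simp
next
  case (Seq P Q)
  then obtain p q where "\<forall>L. cost_bound L P = poly p L" "\<forall>L. cost_bound L Q = poly q L" by blast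
  then show ?case by (intro exI[of _ "p + q"]) simp
next
  case (Cond b P Q)
  then obtain p q where "\<forall>L. cost_bound L P = poly p L" "\<forall>L. cost_bound L Q = poly q L" by blast
  then show ?case by (intro exI[of _ "[:1 + bcost b:] + p + q"]) simp
next
  case (While b P)
  then obtain p where "\<forall>L. cost_bound L P = poly p L" by blast
  \<comment> \<open>The factor \<open>[:1, 1:]\<close> is \<open>L + 1\<close>: the rounds and the
    final failing guard.\<close>
  then show ?case by (intro exI[of _ "[:1, 1:] * ([:1 + bcost b:] + p)"]) simp
qed

text \<open>Termination, cost and postcondition in one predicate: the rules below form a
  weakest-precondition calculus in which program proofs never mention time.\<close>

definition runs :: "nat \<Rightarrow> com \<Rightarrow> state \<Rightarrow> (state \<Rightarrow> bool) \<Rightarrow> bool" where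
  "runs L P s Q \<longleftrightarrow> (\<exists>t s'. exec P s t s' \<and> t \<le> cost_bound L P \<and> Q s')"

lemma runs_conseq: "runs L P s Q \<Longrightarrow> (\<And>s'. Q s' \<Longrightarrow> R s') \<Longrightarrow> runs L P s R"
  unfolding runs_def by blast

lemma runs_Skip: "Q s \<Longrightarrow> runs L Skip s Q"
  unfolding runs_def using exec.Skip by fastforce

lemma runs_NStore: "Q ((fst s)(nval a s := nval b s), snd s) \<Longrightarrow> runs L (NStore a b) s Q"
  unfolding runs_def using exec.NStore by fastforce

lemma runs_RStore: "Q (fst s, (snd s)(nval a s := rval b s)) \<Longrightarrow> runs L (RStore a b) s Q"
  unfolding runs_def using exec.RStore by fastforce

lemma runs_Seq: "runs L P s (\<lambda>s'. runs L R s' Q) \<Longrightarrow> runs L (Seq P R) s Q"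
  unfolding runs_def using exec.Seq by (fastforce intro: add_mono)

lemma runs_Cond:
  assumes "bval b s \<Longrightarrow> runs L P s Q" "\<not> bval b s \<Longrightarrow> runs L R s Q"
  shows "runs L (Cond b P R) s Q"
proof (cases "bval b s")
  case True
  with assms obtain t s' where "exec P s t s'" "t \<le> cost_bound L P" "Q s'" unfolding runs_def by blast
  then show ?thesis unfolding runs_def using exec.CondTrue[OF True] by fastforce
next
  case False
  with assms obtain t s' where "exec R s t s'" "t \<le> cost_bound L R" "Q s'" unfolding runs_def by blast
  then show ?thesis unfolding runs_def using exec.CondFalse[OF False] by fastforce
qed

lemma runs_Cond_if:
  "(if bval b s then runs L P s Q else runs L R s Q) \<Longrightarrow> runs L (Cond b P R) s Q"
  by (rule runs_Cond) auto

text \<open>The invariant is indexed by the number \<open>j\<close> of completed rounds. As the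
  guard amounts to \<open>j < B\<close>, there are exactly \<open>B\<close> rounds and no separate
  variant is needed.\<close>

lemma runs_While:
  assumes "B \<le> L"
    and guard: "\<And>j s. j \<le> B \<Longrightarrow> I j s \<Longrightarrow> bval b s \<longleftrightarrow> j < B"
    and body: "\<And>j s. j < B \<Longrightarrow> I j s \<Longrightarrow> runs L P s (I (Suc j))"
    and I: "I 0 s"
  shows "runs L (While b P) s (I B)"
proof -
  have "\<exists>t s'. exec (While b P) s t s' \<and> t \<le> (k + 1) * (1 + bcost b + cost_bound L P) \<and> I B s'"
    if "j + k = B" "I j s" for j k s
    using that
  proof (induction k arbitrary: j s)
    case 0
    then have "\<not> bval b s" using guard[of j s] by simp
    then show ?case using 0 exec.WhileFalse by fastforce
  next
    case (Suc k)
    then have b: "bval b s" using guard[of j s] by simp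
    obtain t s' where s': "exec P s t s'" "t \<le> cost_bound L P" "I (Suc j) s'"
      using body[of j s] Suc.prems unfolding runs_def by auto
    from Suc.IH[of "Suc j" s'] Suc.prems s' obtain t' s'' where
      s'': "exec (While b P) s' t' s''" "t' \<le> (k + 1) * (1 + bcost b + cost_bound L P)" "I B s''" by auto
    from exec.WhileTrue[OF b s'(1) s''(1)] s'(2) s''(2,3) show ?case
      by (intro exI[of _ "1 + bcost b + t + t'"] exI[of _ s'']) simp
  qed
  from this[of 0 B s] I obtain t s' where t: "exec (While b P) s t s'"
    "t \<le> (B + 1) * (1 + bcost b + cost_bound L P)" "I B s'" by auto
  moreover have "(B + 1) * (1 + bcost b + cost_bound L P) \<le> cost_bound L (While b P)"
    using \<open>B \<le> L\<close> by (simp only: cost_bound.simps mult_le_mono1 add_le_mono1)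
  ultimately show ?thesis unfolding runs_def using order_trans by blast
qed

text \<open>Addresses such as \<open>2 + v\<close> keep the additive form in which the memory
  invariants are stated.\<close>

declare add_2_eq_Suc [simp del] add_2_eq_Suc' [simp del]

section \<open>The algorithm\<close>

abbreviation num_vertices :: nexp where "num_vertices \<equiv> NLoad (NConst 0)"
abbreviation num_edges :: nexp where "num_edges \<equiv> NLoad (NConst 1)"

text \<open>Free memory starts at \<open>2 + n + 3 m\<close>. There we keep the flag of the current Bellman--Ford pass,
  the counters of passes and of edges or vertices, the pair \<open>a\<close>, \<open>b\<close> being tested, the degrees in the
  matching, and the solution. Cell \<open>m + x\<close> of the real memory holds the label of node \<open>x\<close>.\<close>

definition var :: "nat \<Rightarrow> nexp" where
  "var k = NAdd (NAdd (NAdd (NConst 2) num_vertices) (NAdd num_edges (NAdd num_edges num_edges))) (NConst k)"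

abbreviation "flag \<equiv> var 0"
abbreviation "index \<equiv> NLoad (var 2)"
abbreviation "first \<equiv> NLoad (var 3)"
abbreviation "second \<equiv> NLoad (var 4)"

text \<open>An edge occupies three consecutive cells; the machine has no multiplication, so three
  times the index is a sum.\<close>

definition edge_field :: "nat \<Rightarrow> nexp" where
  "edge_field k = NLoad (NAdd (NAdd (NConst (2 + k)) num_vertices) (NAdd index (NAdd index index)))"

definition degree_cell :: "nexp \<Rightarrow> nexp" where
  "degree_cell v = NAdd (var 5) v"

definition solution_cell :: "nexp \<Rightarrow> nexp" where
  "solution_cell v = NAdd (NAdd (var 5) num_vertices) v"

definition capacity :: "nexp \<Rightarrow> nexp" where
  "capacity v = NLoad (NAdd (NConst 2) v)"

definition plus_node :: "nexp \<Rightarrow> nexp" where "plus_node v = NAdd num_edges v"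
definition minus_node :: "nexp \<Rightarrow> nexp" where "minus_node v = NAdd num_edges (NAdd num_vertices v)"

text \<open>The minus copy of the nonvertex \<open>n\<close> is node \<open>n + n\<close>.\<close>

abbreviation "root_node \<equiv> minus_node num_vertices"

definition positive :: "nexp \<Rightarrow> bexp" where
  "positive e = NLess (NConst 0) e"

definition differ :: "nexp \<Rightarrow> nexp \<Rightarrow> bexp" where
  "differ e f = BNot (BAnd (BNot (NLess e f)) (BNot (NLess f e)))"

definition is_active :: "nexp \<Rightarrow> bexp" where
  "is_active v = BNot (BAnd (BNot (positive (NLoad (degree_cell v)))) (BAnd (differ v first) (differ v second)))"

definition for_loop :: "nat \<Rightarrow> nexp \<Rightarrow> com \<Rightarrow> com" where
  "for_loop k N P = Seq (NStore (var k) (NConst 0))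
     (While (NLess (NLoad (var k)) N) (Seq P (NStore (var k) (NAdd (NLoad (var k)) (NConst 1)))))"

definition relax_com :: "nexp \<Rightarrow> nexp \<Rightarrow> rexp \<Rightarrow> com" where
  "relax_com x y g = Cond (RLess (RLoad y) (RAdd (RLoad x) g))
     (Seq (RStore y (RAdd (RLoad x) g)) (NStore flag (NConst 1))) Skip"

definition relax_edge :: com where
  "relax_edge = Cond (BAnd (is_active (edge_field 0)) (is_active (edge_field 1)))
     (Cond (positive (edge_field 2))
       (Seq (relax_com (minus_node (edge_field 0)) (plus_node (edge_field 1)) (RSub RZero (RLoad index)))
            (relax_com (minus_node (edge_field 1)) (plus_node (edge_field 0)) (RSub RZero (RLoad index))))
       (Seq (relax_com (plus_node (edge_field 0)) (minus_node (edge_field 1)) (RLoad index))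
            (relax_com (plus_node (edge_field 1)) (minus_node (edge_field 0)) (RLoad index))))
     Skip"

definition relax_vertex :: com where
  "relax_vertex = Cond (is_active index)
     (Seq
       (Cond (NLess (NLoad (degree_cell index)) (capacity index))
         (Seq (relax_com root_node (plus_node index) RZero) (relax_com (minus_node index) root_node RZero))
         Skip)
       (Cond (positive (NLoad (degree_cell index)))
         (Seq (relax_com (plus_node index) root_node RZero) (relax_com root_node (minus_node index) RZero))
         Skip))
     Skip"

text \<open>The number of passes exceeds the number \<open>2 * n + 1\<close> of nodes. Labels are
  not reset between calls, since the criterion holds for arbitrary initial labels.\<close>

definition find_pos_cycle :: com where
  "find_pos_cycle = for_loop 1 (NAdd (NAdd num_vertices num_vertices) (NConst 2))
     (Seq (NStore flag (NConst 0))
       (Seq (for_loop 2 num_edges relax_edge) (for_loop 2 num_vertices relax_vertex)))"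

definition increment :: "nexp \<Rightarrow> com" where
  "increment a = NStore a (NAdd (NLoad a) (NConst 1))"

definition compute_degrees :: com where
  "compute_degrees = for_loop 2 num_edges
     (Cond (positive (edge_field 2))
       (Seq (increment (degree_cell (edge_field 0))) (increment (degree_cell (edge_field 1)))) Skip)"

definition is_free :: "nexp \<Rightarrow> bexp" where
  "is_free v = BAnd (BNot (positive (NLoad (degree_cell v)))) (BNot (positive (NLoad (solution_cell v))))"

text \<open>Freeness is tested anew for every pair, so a marked vertex never takes part again and
  the chosen pairs are disjoint.\<close>

definition select_pairs :: com where
  "select_pairs = for_loop 3 num_vertices (for_loop 4 num_vertices
     (Cond (BAnd (is_free first) (is_free second))
       (Seq find_pos_cycle
         (Cond (positive (NLoad flag))
           (Seq (NStore (solution_cell first) (NConst 1)) (NStore (solution_cell second) (NConst 1))) Skip))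
       Skip))"

text \<open>The output overwrites cells from which addresses are computed, so cells 1 and 0 are
  written last. The final round of the loop copies one cell past the solution to cell
  \<open>n + 1\<close>, outside the reported range.\<close>

definition write_solution :: com where
  "write_solution = Seq
     (for_loop 2 num_vertices (NStore (NAdd (NConst 2) index) (NLoad (solution_cell (NAdd index (NConst 1))))))
     (Seq (NStore (NConst 1) (NLoad (solution_cell (NConst 0)))) (NStore (NConst 0) (NConst 1)))"

text \<open>After the selection the counter \<open>first\<close> has reached \<open>n\<close>; with
  \<open>second\<close> set to \<open>n\<close> as well, the last test concerns
  \<open>active n n\<close>, that is, feasibility.\<close>

definition stabilizer_com :: com where
  "stabilizer_com = Seq compute_degrees (Seq select_pairs (Seq (NStore (var 4) num_vertices)
     (Seq find_pos_cycle (Cond (positive (NLoad flag)) (NStore (NConst 0) (NConst 0)) write_solution))))"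

lemma bval_positive [simp]: "bval (positive e) s \<longleftrightarrow> 0 < nval e s"
  by (simp add: positive_def)

lemma bval_differ [simp]: "bval (differ e f) s \<longleftrightarrow> nval e s \<noteq> nval f s"
  by (auto simp: differ_def)

lemma nth_concat_triples:
  "j < length xs \<Longrightarrow> k < 3 \<Longrightarrow>
     concat (map (\<lambda>(u, v). [u, v, f u v]) xs) ! (3 * j + k) =
     [fst (xs ! j), snd (xs ! j), f (fst (xs ! j)) (snd (xs ! j))] ! k"
proof (induction xs arbitrary: j)
  case (Cons x xs)
  show ?case
  proof (cases j)
    case 0
    moreover have "k = 0 \<or> k = 1 \<or> k = 2" using Cons.prems by auto
    ultimately show ?thesis by (cases x) auto
  next
    case (Suc i)
    have "3 * j + k = 3 + (3 * i + k)" using Suc by simp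
    then show ?thesis using Cons.IH[of i] Cons.prems Suc by (cases x) (simp add: nth_append eval_nat_numeral)
  qed
qed simp

lemma length_concat_triples: "length (concat (map (\<lambda>(u, v). [u, v, f u v]) xs)) = 3 * length xs"
  by (induction xs) auto

section \<open>Memory invariants of the program\<close>

context matching_instance begin

abbreviation "m \<equiv> length es"

definition base :: nat where
  "base = 2 + n + 3 * m"

definition header :: "state \<Rightarrow> bool" where
  "header s \<longleftrightarrow> fst s 0 = n \<and> fst s 1 = m"

lemma nval_var [simp]: "header s \<Longrightarrow> nval (var k) s = base + k"
  by (simp add: var_def header_def base_def)

lemma nval_cells [simp]:
  assumes "header s"
  shows "nval (degree_cell v) s = base + 5 + nval v s"
    "nval (solution_cell v) s = base + 5 + n + nval v s"
    "nval (plus_node v) s = m + nval v s" "nval (minus_node v) s = m + (n + nval v s)"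
  using assms by (simp_all add: degree_cell_def solution_cell_def plus_node_def minus_node_def)
     (simp_all add: header_def)

lemma header_update:
  "1 < i \<Longrightarrow> header s \<Longrightarrow> header ((fst s)(i := x), r)"
  by (simp add: header_def)

text \<open>The body must leave the counter alone, and the invariant is claimed after the counter
  has advanced, so \<open>I\<close> may speak about the whole memory.\<close>

lemma runs_for_loop:
  assumes "B \<le> L" "header s"
    and bound: "\<And>j s. I j s \<Longrightarrow> header s \<and> nval N s = B"
    and body: "\<And>j s. j < B \<Longrightarrow> I j s \<Longrightarrow> fst s (base + k) = j \<Longrightarrow>
      runs L P s (\<lambda>s'. header s' \<and> fst s' (base + k) = j \<and> I (Suc j) ((fst s')(base + k := Suc j), snd s'))"
    and init: "I 0 ((fst s)(base + k := 0), snd s)"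
    and final: "\<And>s. I B s \<Longrightarrow> fst s (base + k) = B \<Longrightarrow> Q s"
  shows "runs L (for_loop k N P) s Q"
  unfolding for_loop_def
proof (intro runs_Seq runs_NStore)
  let ?I = "\<lambda>j s. I j s \<and> fst s (base + k) = j"
  have "runs L (While (NLess (NLoad (var k)) N) (Seq P (NStore (var k) (NAdd (NLoad (var k)) (NConst 1)))))
     ((fst s)(base + k := 0), snd s) (?I B)"
  proof (rule runs_While[OF assms(1)])
    show "?I 0 ((fst s)(base + k := 0), snd s)" using init by simp
    show "bval (NLess (NLoad (var k)) N) s = (j < B)" if "?I j s" for j s
      using that bound[of j s] by auto
    show "runs L (Seq P (NStore (var k) (NAdd (NLoad (var k)) (NConst 1)))) s (?I (Suc j))"
      if "j < B" "?I j s" for j s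
      using that by (auto intro!: runs_Seq runs_conseq[OF body[OF that(1)]] runs_NStore)
  qed
  then show "runs L (While (NLess (NLoad (var k)) N) (Seq P (NStore (var k) (NAdd (NLoad (var k)) (NConst 1)))))
     ((fst s)(nval (var k) s := nval (NConst 0) s), snd s) Q"
    using assms(2) by (auto elim!: runs_conseq intro: final)
qed

definition input :: "state \<Rightarrow> bool" where
  "input s \<longleftrightarrow> header s \<and> (\<forall>v<n. fst s (2 + v) = c v) \<and>
     (\<forall>j<m. fst s (2 + n + 3 * j) = fst (es ! j) \<and> fst s (3 + n + 3 * j) = snd (es ! j) \<and>
        (0 < fst s (4 + n + 3 * j) \<longleftrightarrow> {fst (es ! j), snd (es ! j)} \<in> M) \<and>
        snd s j = w {fst (es ! j), snd (es ! j)})"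

lemma input_cong:
  assumes "input s" "\<And>i. i < base \<Longrightarrow> fst s' i = fst s i" "\<And>i. i < m \<Longrightarrow> snd s' i = snd s i"
  shows "input s'"
  using assms unfolding input_def header_def base_def by auto

lemma input_header: "input s \<Longrightarrow> header s"
  by (simp add: input_def)

lemma nth_es: "j < m \<Longrightarrow> {fst (es ! j), snd (es ! j)} \<in> E"
  using mem_es[of "fst (es ! j)" "snd (es ! j)"] by simp

lemma nval_edge_field:
  assumes "input s" "fst s (base + 2) = j" "j < m"
  shows "nval (edge_field 0) s = fst (es ! j)" "nval (edge_field 1) s = snd (es ! j)"
    "nval (edge_field (Suc 0)) s = snd (es ! j)"
    "0 < nval (edge_field 2) s \<longleftrightarrow> {fst (es ! j), snd (es ! j)} \<in> M"
proof -
  have *: "nval (edge_field k) s = fst s (2 + k + n + 3 * j)" for k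
  proof -
    have "2 + k + n + (j + (j + j)) = 2 + k + n + 3 * j" by simp
    then show ?thesis using assms input_header[OF assms(1)]
      by (simp add: edge_field_def del: nval.simps(1) One_nat_def) (simp add: header_def ac_simps)
  qed
  show "nval (edge_field 0) s = fst (es ! j)" "nval (edge_field 1) s = snd (es ! j)"
    "nval (edge_field (Suc 0)) s = snd (es ! j)"
    "0 < nval (edge_field 2) s \<longleftrightarrow> {fst (es ! j), snd (es ! j)} \<in> M"
    unfolding * using assms(1,3) unfolding input_def by (simp_all add: eval_nat_numeral)
qed

definition loaded :: "state \<Rightarrow> bool" where
  "loaded s \<longleftrightarrow> input s \<and> (\<forall>v<n. fst s (base + 5 + v) = deg v)"

definition testing :: "nat \<Rightarrow> nat \<Rightarrow> state \<Rightarrow> bool" where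
  "testing a b s \<longleftrightarrow> loaded s \<and> fst s (base + 3) = a \<and> fst s (base + 4) = b"

lemma testing_header: "testing a b s \<Longrightarrow> header s"
  by (simp add: testing_def loaded_def input_header)

lemma bval_is_active:
  assumes "testing a b s" "nval e s < n"
  shows "bval (is_active e) s \<longleftrightarrow> nval e s \<in> active a b"
  using assms testing_header[OF assms(1)]
  by (auto simp: is_active_def active_def testing_def loaded_def)

text \<open>Abstraction from memory to the pair on which \<open>relax\<close> operates; machine and
  functional algorithm are compared through it.\<close>

definition labels :: "state \<Rightarrow> (nat \<Rightarrow> real) \<times> bool" where
  "labels s = (\<lambda>x. snd s (m + x), 0 < fst s base)"

definition relaxed :: "arc list \<Rightarrow> state \<Rightarrow> state \<Rightarrow> bool" where
  "relaxed as s s' \<longleftrightarrow> labels s' = fold relax as (labels s) \<and>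
     (\<forall>i. i \<noteq> base \<longrightarrow> fst s' i = fst s i) \<and> (\<forall>i<m. snd s' i = snd s i)"

lemma relaxed_Nil: "relaxed [] s s"
  by (simp add: relaxed_def)

lemma relaxed_append: "relaxed as s s' \<Longrightarrow> relaxed bs s' s'' \<Longrightarrow> relaxed (as @ bs) s s''"
  by (simp add: relaxed_def)

lemma relaxedD:
  assumes "relaxed as s s'"
  shows "i \<noteq> base \<Longrightarrow> fst s' i = fst s i" "i < m \<Longrightarrow> snd s' i = snd s i"
  using assms unfolding relaxed_def by blast+

lemma relaxed_testing:
  assumes "relaxed as s s'" "testing a b s"
  shows "testing a b s'"
proof -
  have "input s" using assms(2) by (simp add: testing_def loaded_def)
  then have "input s'" by (rule input_cong) (simp_all add: relaxedD[OF assms(1)])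
  then show ?thesis using assms(2) by (simp add: relaxedD[OF assms(1)] testing_def loaded_def)
qed

lemma runs_relax_com:
  assumes "header s" "nval x s = m + X" "nval y s = m + Y" "rval g s = G"
  shows "runs L (relax_com x y g) s (relaxed [(X, Y, G)] s)"
proof -
  have "1 < base" by (simp add: base_def)
  then have "header ((fst s), (snd s)(m + Y := snd s (m + X) + G))" using assms(1) by (simp add: header_def)
  then show ?thesis unfolding relax_com_def
    using assms by (intro runs_Cond runs_Seq runs_RStore runs_NStore runs_Skip)
      (auto simp: relaxed_def labels_def)
qed

text \<open>The second relaxation evaluates its operands in the state left by the first; assuming
  their values in all relaxed states settles both.\<close>

lemma runs_relax_two:
  assumes "\<And>as s'. relaxed as s s' \<Longrightarrow> header s' \<and>
      nval x1 s' = m + X1 \<and> nval y1 s' = m + Y1 \<and> rval g1 s' = G1 \<and>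
      nval x2 s' = m + X2 \<and> nval y2 s' = m + Y2 \<and> rval g2 s' = G2"
  shows "runs L (Seq (relax_com x1 y1 g1) (relax_com x2 y2 g2)) s
      (relaxed [(X1, Y1, G1), (X2, Y2, G2)] s)"
proof (rule runs_Seq, rule runs_conseq[OF runs_relax_com])
  fix s' assume s': "relaxed [(X1, Y1, G1)] s s'"
  show "runs L (relax_com x2 y2 g2) s' (relaxed [(X1, Y1, G1), (X2, Y2, G2)] s)"
    by (rule runs_conseq[OF runs_relax_com])
       (use assms[OF s'] relaxed_append[OF s', of "[(X2, Y2, G2)]"] in auto)
qed (use assms[OF relaxed_Nil] in auto)

lemma runs_relax_edge:
  assumes s: "testing a b s" "fst s (base + 2) = j" and j: "j < m"
  shows "runs L relax_edge s (relaxed (edge_arcs (active a b) (es ! j)) s)"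
proof -
  obtain u v where uv: "es ! j = (u, v)" by (cases "es ! j")
  have e: "u < n" "v < n" "u \<noteq> v" using edge_vertices nth_es[OF j] uv by auto
  have ev: "header s'" "nval (edge_field 0) s' = u" "nval (edge_field (Suc 0)) s' = v"
     "0 < nval (edge_field 2) s' \<longleftrightarrow> {u, v} \<in> M" "nval index s' = j" "snd s' j = w {u, v}"
    if "testing a b s'" "fst s' (base + 2) = j" for s'
  proof -
    have "input s'" using that by (simp add: testing_def loaded_def)
    from nval_edge_field[OF this that(2) j] input_header[OF this] this that j uv
    show "header s'" "nval (edge_field 0) s' = u" "nval (edge_field (Suc 0)) s' = v"
     "0 < nval (edge_field 2) s' \<longleftrightarrow> {u, v} \<in> M" "nval index s' = j" "snd s' j = w {u, v}"
      by (auto simp: input_def)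
  qed
  have ev': "header s'" "nval (edge_field 0) s' = u" "nval (edge_field (Suc 0)) s' = v"
     "nval index s' = j" "snd s' j = w {u, v}"
    if "relaxed as s s'" for as s'
    using ev[of s'] relaxed_testing[OF that s(1)] s(2) by (simp_all add: relaxedD[OF that])
  have act: "bval (is_active (edge_field 0)) s \<longleftrightarrow> u \<in> active a b"
     "bval (is_active (edge_field (Suc 0))) s \<longleftrightarrow> v \<in> active a b"
    using bval_is_active[OF s(1)] ev[OF s] e by auto
  have 1: "runs L (Seq (relax_com (minus_node (edge_field 0)) (plus_node (edge_field 1)) (RSub RZero (RLoad index)))
            (relax_com (minus_node (edge_field 1)) (plus_node (edge_field 0)) (RSub RZero (RLoad index)))) s
      (relaxed [(n + u, v, - w {u, v}), (n + v, u, - w {u, v})] s)"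
    by (rule runs_relax_two) (simp add: ev' del: nval.simps)
  have 2: "runs L (Seq (relax_com (plus_node (edge_field 0)) (minus_node (edge_field 1)) (RLoad index))
            (relax_com (plus_node (edge_field 1)) (minus_node (edge_field 0)) (RLoad index))) s
      (relaxed [(u, n + v, w {u, v}), (v, n + u, w {u, v})] s)"
    by (rule runs_relax_two) (simp add: ev' del: nval.simps)
  show ?thesis
    unfolding relax_edge_def
    using 1 2 act ev(4)[OF s]
    by (auto simp: uv edge_arcs_def relaxed_Nil intro!: runs_Cond_if runs_Skip)
qed

lemma runs_relax_vertex:
  assumes s: "testing a b s" "fst s (base + 2) = v" and v: "v < n"
  shows "runs L relax_vertex s (relaxed (vertex_arcs (active a b) v) s)"
proof -
  have ev: "header s'" "nval index s' = v" "nval num_vertices s' = n" "nval (capacity index) s' = c v"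
     "nval (NLoad (degree_cell index)) s' = deg v"
    if "relaxed as s s'" for as s'
  proof -
    have t: "testing a b s'" by (rule relaxed_testing[OF that s(1)])
    show "header s'" by (rule testing_header[OF t])
    then show "nval index s' = v" "nval num_vertices s' = n" "nval (capacity index) s' = c v"
     "nval (NLoad (degree_cell index)) s' = deg v"
      using t s v relaxedD(1)[OF that, of "base + 2"]
      by (simp_all add: testing_def loaded_def capacity_def input_def del: One_nat_def) (simp add: header_def)
  qed
  note ev0 = ev[OF relaxed_Nil]
  have act: "bval (is_active index) s \<longleftrightarrow> v \<in> active a b"
    using bval_is_active[OF s(1), of index] ev0 v by auto
  have 1: "runs L (Cond (NLess (NLoad (degree_cell index)) (capacity index))
         (Seq (relax_com root_node (plus_node index) RZero) (relax_com (minus_node index) root_node RZero))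
         Skip) s (relaxed (if deg v < c v then [(n + n, v, 0), (n + v, n + n, 0)] else []) s)"
    by (rule runs_Cond_if) (simp add: ev ev0 runs_relax_two runs_Skip relaxed_Nil del: nval.simps)
  have 2: "runs L (Cond (positive (NLoad (degree_cell index)))
         (Seq (relax_com (plus_node index) root_node RZero) (relax_com root_node (minus_node index) RZero))
         Skip) s' (relaxed (if 0 < deg v then [(v, n + n, 0), (n + n, n + v, 0)] else []) s')"
    if "relaxed as s s'" for as s'
    using ev[OF relaxed_append[OF that]] ev[OF that]
    by (intro runs_Cond_if) (simp add: runs_relax_two runs_Skip relaxed_Nil del: nval.simps)
  show ?thesis
  proof (cases "v \<in> active a b")
    case True
    have "runs L (Seq
       (Cond (NLess (NLoad (degree_cell index)) (capacity index))
         (Seq (relax_com root_node (plus_node index) RZero) (relax_com (minus_node index) root_node RZero))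
         Skip)
       (Cond (positive (NLoad (degree_cell index)))
         (Seq (relax_com (plus_node index) root_node RZero) (relax_com root_node (minus_node index) RZero))
         Skip)) s (relaxed (vertex_arcs (active a b) v) s)"
      unfolding vertex_arcs_def if_P[OF True]
      by (rule runs_Seq, rule runs_conseq[OF 1], rule runs_conseq[OF 2], assumption, rule relaxed_append)
    then show ?thesis unfolding relax_vertex_def by (intro runs_Cond_if) (use True act in simp)
  next
    case False
    then show ?thesis unfolding relax_vertex_def
      by (intro runs_Cond_if) (use act in \<open>simp add: vertex_arcs_def runs_Skip relaxed_Nil\<close>)
  qed
qed



text \<open>Frame of a whole Bellman-Ford run: the work cells \<open>base\<close> to
  \<open>base + 2\<close> and the labels may change, whereas the tested pair, degrees and marks
  stay.\<close>

definition preserved :: "state \<Rightarrow> state \<Rightarrow> bool" where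
  "preserved s s' \<longleftrightarrow> (\<forall>i. i < base \<or> base + 2 < i \<longrightarrow> fst s' i = fst s i) \<and> (\<forall>i<m. snd s' i = snd s i)"

lemma preserved_refl: "preserved s s"
  by (simp add: preserved_def)

lemma preserved_update: "preserved s s' \<Longrightarrow> k \<le> 2 \<Longrightarrow> preserved s ((fst s')(base + k := x), snd s')"
  by (auto simp: preserved_def)

lemma preserved_relaxed: "preserved s s' \<Longrightarrow> relaxed as s' s'' \<Longrightarrow> preserved s s''"
  by (simp add: preserved_def relaxedD)

lemma preserved_testing:
  assumes "preserved s s'" "testing a b s"
  shows "testing a b s'"
proof -
  have "input s" using assms(2) by (simp add: testing_def loaded_def)
  then have "input s'" by (rule input_cong) (use assms(1) in \<open>simp_all add: preserved_def\<close>)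
  then show ?thesis using assms by (simp add: preserved_def testing_def loaded_def)
qed

lemma labels_update: "0 < k \<Longrightarrow> labels ((fst s)(base + k := x), snd s) = labels s"
  by (simp add: labels_def)

section \<open>Bellman-Ford passes in memory\<close>

lemma runs_edge_loop:
  assumes s: "testing a b s0" "preserved s0 s" and L: "m \<le> L"
  shows "runs L (for_loop 2 num_edges relax_edge) s
    (\<lambda>s'. preserved s0 s' \<and> labels s' = fold relax (concat (map (edge_arcs (active a b)) es)) (labels s) \<and>
       fst s' (base + 1) = fst s (base + 1))"
proof (rule runs_for_loop[where B = m and I = "\<lambda>j s'. preserved s0 s' \<and>
     labels s' = fold relax (concat (map (edge_arcs (active a b)) (take j es))) (labels s) \<and>
     fst s' (base + 1) = fst s (base + 1)"])
  fix j s'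
  assume I: "preserved s0 s' \<and>
     labels s' = fold relax (concat (map (edge_arcs (active a b)) (take j es))) (labels s) \<and>
     fst s' (base + 1) = fst s (base + 1)"
  then have t: "testing a b s'" using preserved_testing s(1) by blast
  then show "header s' \<and> nval num_edges s' = m" using testing_header by (simp add: header_def)
  assume j: "j < m" "fst s' (base + 2) = j"
  show "runs L relax_edge s' (\<lambda>s''. header s'' \<and> fst s'' (base + 2) = j \<and>
     preserved s0 ((fst s'')(base + 2 := Suc j), snd s'') \<and>
     labels ((fst s'')(base + 2 := Suc j), snd s'') =
       fold relax (concat (map (edge_arcs (active a b)) (take (Suc j) es))) (labels s) \<and>
     fst ((fst s'')(base + 2 := Suc j), snd s'') (base + 1) = fst s (base + 1))"
  proof (rule runs_conseq[OF runs_relax_edge[OF t j(2,1)]])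
    fix s'' assume r: "relaxed (edge_arcs (active a b) (es ! j)) s' s''"
    have p: "preserved s0 s''" using I r preserved_relaxed by blast
    show "header s'' \<and> fst s'' (base + 2) = j \<and>
     preserved s0 ((fst s'')(base + 2 := Suc j), snd s'') \<and>
     labels ((fst s'')(base + 2 := Suc j), snd s'') =
       fold relax (concat (map (edge_arcs (active a b)) (take (Suc j) es))) (labels s) \<and>
     fst ((fst s'')(base + 2 := Suc j), snd s'') (base + 1) = fst s (base + 1)"
      using testing_header[OF relaxed_testing[OF r t]] preserved_update[OF p, of 2] I j r relaxedD(1)[OF r]
      by (simp add: labels_update take_Suc_conv_app_nth relaxed_def)
  qed
next
  show "preserved s0 ((fst s)(base + 2 := 0), snd s) \<and>
     labels ((fst s)(base + 2 := 0), snd s) = fold relax (concat (map (edge_arcs (active a b)) (take 0 es))) (labels s) \<and>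
     fst ((fst s)(base + 2 := 0), snd s) (base + 1) = fst s (base + 1)"
    using preserved_update[OF s(2), of 2] by (simp add: labels_update)
qed (use L testing_header[OF preserved_testing[OF s(2,1)]] in simp_all)

lemma runs_vertex_loop:
  assumes s: "testing a b s0" "preserved s0 s" and L: "n \<le> L"
  shows "runs L (for_loop 2 num_vertices relax_vertex) s
    (\<lambda>s'. preserved s0 s' \<and> labels s' = fold relax (concat (map (vertex_arcs (active a b)) [0..<n])) (labels s) \<and>
       fst s' (base + 1) = fst s (base + 1))"
proof (rule runs_for_loop[where B = n and I = "\<lambda>j s'. preserved s0 s' \<and>
     labels s' = fold relax (concat (map (vertex_arcs (active a b)) [0..<j])) (labels s) \<and>
     fst s' (base + 1) = fst s (base + 1)"])
  fix j s'
  assume I: "preserved s0 s' \<and>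
     labels s' = fold relax (concat (map (vertex_arcs (active a b)) [0..<j])) (labels s) \<and>
     fst s' (base + 1) = fst s (base + 1)"
  then have t: "testing a b s'" using preserved_testing s(1) by blast
  then show "header s' \<and> nval num_vertices s' = n" using testing_header by (simp add: header_def)
  assume j: "j < n" "fst s' (base + 2) = j"
  show "runs L relax_vertex s' (\<lambda>s''. header s'' \<and> fst s'' (base + 2) = j \<and>
     preserved s0 ((fst s'')(base + 2 := Suc j), snd s'') \<and>
     labels ((fst s'')(base + 2 := Suc j), snd s'') =
       fold relax (concat (map (vertex_arcs (active a b)) [0..<Suc j])) (labels s) \<and>
     fst ((fst s'')(base + 2 := Suc j), snd s'') (base + 1) = fst s (base + 1))"
  proof (rule runs_conseq[OF runs_relax_vertex[OF t j(2,1)]])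
    fix s'' assume r: "relaxed (vertex_arcs (active a b) j) s' s''"
    have p: "preserved s0 s''" using I r preserved_relaxed by blast
    show "header s'' \<and> fst s'' (base + 2) = j \<and>
     preserved s0 ((fst s'')(base + 2 := Suc j), snd s'') \<and>
     labels ((fst s'')(base + 2 := Suc j), snd s'') =
       fold relax (concat (map (vertex_arcs (active a b)) [0..<Suc j])) (labels s) \<and>
     fst ((fst s'')(base + 2 := Suc j), snd s'') (base + 1) = fst s (base + 1)"
      using testing_header[OF relaxed_testing[OF r t]] preserved_update[OF p, of 2] I j r relaxedD(1)[OF r]
      by (simp add: labels_update relaxed_def)
  qed
next
  show "preserved s0 ((fst s)(base + 2 := 0), snd s) \<and>
     labels ((fst s)(base + 2 := 0), snd s) = fold relax (concat (map (vertex_arcs (active a b)) [0..<0])) (labels s) \<and>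
     fst ((fst s)(base + 2 := 0), snd s) (base + 1) = fst s (base + 1)"
    using preserved_update[OF s(2), of 2] by (simp add: labels_update)
qed (use L testing_header[OF preserved_testing[OF s(2,1)]] in simp_all)

lemma runs_find_pos_cycle:
  assumes s0: "testing a b s0" and L: "m \<le> L" "2 * n + 2 \<le> L"
  shows "runs L find_pos_cycle s0
    (\<lambda>s. preserved s0 s \<and> (0 < fst s base \<longleftrightarrow> pos_cycle (set (arcs (active a b)))))"
  unfolding find_pos_cycle_def
proof (rule runs_for_loop[where B = "2 * n + 2" and
      I = "\<lambda>j s. preserved s0 s \<and> labels s = (pass (arcs (active a b)) ^^ j) (labels s0)"])
  fix j s
  assume I: "preserved s0 s \<and> labels s = (pass (arcs (active a b)) ^^ j) (labels s0)"
  then have t: "testing a b s" using preserved_testing s0 by blast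
  then show "header s \<and> nval (NAdd (NAdd num_vertices num_vertices) (NConst 2)) s = 2 * n + 2"
    using testing_header by (simp add: header_def)
  assume j: "j < 2 * n + 2" "fst s (base + 1) = j"
  let ?s = "((fst s)(base := 0), snd s)"
  have p: "preserved s0 ?s" using preserved_update[of s0 s 0] I by simp
  \<comment> \<open>Clearing the flag cell is the reset performed by \<open>pass\<close>.\<close>
  have lab: "labels ?s = (fst (labels s), False)" by (simp add: labels_def)
  have base1: "base \<noteq> base + 1" by simp
  have loops: "runs L (Seq (for_loop 2 num_edges relax_edge) (for_loop 2 num_vertices relax_vertex)) ?s
    (\<lambda>s'. header s' \<and> fst s' (base + 1) = j \<and>
       preserved s0 ((fst s')(base + 1 := Suc j), snd s') \<and>
       labels ((fst s')(base + 1 := Suc j), snd s') = (pass (arcs (active a b)) ^^ Suc j) (labels s0))"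
  proof (rule runs_Seq, rule runs_conseq[OF runs_edge_loop[OF s0 p L(1)]], elim conjE)
    fix s1
    assume s1: "preserved s0 s1" "fst s1 (base + 1) = fst ?s (base + 1)"
      "labels s1 = fold relax (concat (map (edge_arcs (active a b)) es)) (labels ?s)"
    show "runs L (for_loop 2 num_vertices relax_vertex) s1 (\<lambda>s'. header s' \<and> fst s' (base + 1) = j \<and>
       preserved s0 ((fst s')(base + 1 := Suc j), snd s') \<and>
       labels ((fst s')(base + 1 := Suc j), snd s') = (pass (arcs (active a b)) ^^ Suc j) (labels s0))"
    proof (rule runs_conseq[OF runs_vertex_loop[OF s0 s1(1)]], use L in simp, elim conjE)
      fix s2
      assume s2: "preserved s0 s2" "fst s2 (base + 1) = fst s1 (base + 1)"
        "labels s2 = fold relax (concat (map (vertex_arcs (active a b)) [0..<n])) (labels s1)"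
      have "labels s2 = fold relax (arcs (active a b)) (fst (labels s), False)"
        unfolding s2 s1 lab arcs_def by simp
      then have "labels s2 = (pass (arcs (active a b)) ^^ Suc j) (labels s0)"
        using I unfolding passes_Suc by simp
      then show "header s2 \<and> fst s2 (base + 1) = j \<and>
       preserved s0 ((fst s2)(base + 1 := Suc j), snd s2) \<and>
       labels ((fst s2)(base + 1 := Suc j), snd s2) = (pass (arcs (active a b)) ^^ Suc j) (labels s0)"
        using testing_header[OF preserved_testing[OF s2(1) s0]] preserved_update[OF s2(1), of 1]
          s2(2) s1(2) j base1 labels_update[of 1 s2 "Suc j"] by (simp del: funpow.simps One_nat_def)
    qed
  qed
  have store: "((fst s)(nval flag s := nval (NConst 0) s), snd s) = ?s"
    using testing_header[OF t] by simp
  show "runs L (Seq (NStore flag (NConst 0))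
       (Seq (for_loop 2 num_edges relax_edge) (for_loop 2 num_vertices relax_vertex))) s
    (\<lambda>s'. header s' \<and> fst s' (base + 1) = j \<and>
       preserved s0 ((fst s')(base + 1 := Suc j), snd s') \<and>
       labels ((fst s')(base + 1 := Suc j), snd s') = (pass (arcs (active a b)) ^^ Suc j) (labels s0))"
    by (rule runs_Seq, rule runs_NStore, unfold store, rule loops)
next
  show "preserved s0 ((fst s0)(base + 1 := 0), snd s0) \<and>
     labels ((fst s0)(base + 1 := 0), snd s0) = (pass (arcs (active a b)) ^^ 0) (labels s0)"
    using preserved_update[OF preserved_refl, of 1 s0 0] labels_update[of 1 s0 0] by simp
next
  fix s assume "preserved s0 s \<and> labels s = (pass (arcs (active a b)) ^^ (2 * n + 2)) (labels s0)"
  moreover have "snd (labels s) \<longleftrightarrow> 0 < fst s base" by (simp add: labels_def)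
  moreover have "snd ((pass (arcs (active a b)) ^^ (2 * n + 2)) (labels s0)) \<longleftrightarrow>
      pos_cycle (set (arcs (active a b)))"
    using bellman_ford[of "arcs (active a b)" "n + n + 1" "2 * n + 2" "fst (labels s0)" "snd (labels s0)"]
      arc_source[OF active_subset] by simp
  ultimately show "preserved s0 s \<and> (0 < fst s base \<longleftrightarrow> pos_cycle (set (arcs (active a b))))" by simp
qed (use L testing_header[OF s0] in simp_all)

section \<open>Degrees in the given matching\<close>

definition incidences :: "nat \<Rightarrow> nat \<Rightarrow> nat" where
  "incidences j v = length (filter (\<lambda>(x, y). {x, y} \<in> M \<and> (v = x \<or> v = y)) (take j es))"

text \<open>Every edge is listed exactly once, so counting list entries counts edges of
  \<open>M\<close>.\<close>

lemma incidences_all: "incidences m v = deg v"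
proof -
  let ?f = "\<lambda>(x, y). {x, y}" and ?P = "\<lambda>(x, y). {x, y} \<in> M \<and> (v = x \<or> v = y)"
  have "set (map ?f (filter ?P es)) = {e \<in> M. v \<in> e}"
  proof (intro equalityI subsetI)
    fix e assume e: "e \<in> {e \<in> M. v \<in> e}"
    then have "e \<in> set (map ?f es)" using edges matching_edges unfolding edge_list_def by blast
    then obtain x y where "(x, y) \<in> set es" "e = {x, y}" by auto
    with e show "e \<in> set (map ?f (filter ?P es))" by force
  qed auto
  moreover have "distinct (map ?f (filter ?P es))"
    using edges unfolding edge_list_def by (auto intro: distinct_map_filter)
  ultimately show ?thesis
    unfolding incidences_def deg_def using distinct_card[of "map ?f (filter ?P es)"] by simp
qed

lemma incidences_Suc:
  assumes "j < m" "es ! j = (x, y)"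
  shows "incidences (Suc j) v = incidences j v + of_bool ({x, y} \<in> M \<and> (v = x \<or> v = y))"
  using assms unfolding incidences_def by (simp add: take_Suc_conv_app_nth)

lemma input_update: "input s \<Longrightarrow> base \<le> i \<Longrightarrow> input ((fst s)(i := x), snd s)"
  by (rule input_cong) auto

lemma runs_compute_degrees:
  assumes s0: "input s0" "\<And>i. base \<le> i \<Longrightarrow> fst s0 i = 0" and L: "m \<le> L"
  shows "runs L compute_degrees s0 (\<lambda>s. loaded s \<and> (\<forall>v<n. fst s (base + 5 + n + v) = 0))"
  unfolding compute_degrees_def
proof (rule runs_for_loop[where B = m and I = "\<lambda>j s. input s \<and>
    (\<forall>v<n. fst s (base + 5 + v) = incidences j v \<and> fst s (base + 5 + n + v) = 0)"])
  fix j s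
  assume I: "input s \<and> (\<forall>v<n. fst s (base + 5 + v) = incidences j v \<and> fst s (base + 5 + n + v) = 0)"
  then have h: "header s" using input_header by blast
  then show "header s \<and> nval num_edges s = m" by (simp add: header_def)
  assume j: "j < m" "fst s (base + 2) = j"
  obtain x y where xy: "es ! j = (x, y)" by (cases "es ! j")
  have e: "x < n" "y < n" "x \<noteq> y" using edge_vertices nth_es[OF j(1)] xy by auto
  have ev: "nval (edge_field 0) s = x" "nval (edge_field (Suc 0)) s = y" "0 < nval (edge_field 2) s \<longleftrightarrow> {x, y} \<in> M"
    using nval_edge_field[OF _ j(2,1)] I xy by auto
  let ?s = "((fst s)(base + 5 + x := Suc (incidences j x)), snd s)"
  have s': "input ?s" using I input_update by simp
  then have h': "header ?s" using input_header by blast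
  have ev': "nval (edge_field (Suc 0)) ?s = y"
    using nval_edge_field[OF s' _ j(1)] j(2) xy by auto
  \<comment> \<open>As \<open>x\<close> and \<open>y\<close> differ, the second counter still has
    its old value.\<close>
  let ?t = "((fst ?s)(base + 5 + y := Suc (incidences j y)), snd ?s)"
  have t: "input ?t" using input_update[OF s'] by simp
  then have h'': "header ?t" using input_header by blast
  show "runs L (Cond (positive (edge_field 2))
       (Seq (increment (degree_cell (edge_field 0))) (increment (degree_cell (edge_field 1)))) Skip) s
    (\<lambda>s'. header s' \<and> fst s' (base + 2) = j \<and> input ((fst s')(base + 2 := Suc j), snd s') \<and>
       (\<forall>v<n. fst ((fst s')(base + 2 := Suc j), snd s') (base + 5 + v) = incidences (Suc j) v \<and>
          fst ((fst s')(base + 2 := Suc j), snd s') (base + 5 + n + v) = 0))"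
    unfolding increment_def
  proof (rule runs_Cond, rule runs_Seq, rule runs_NStore, rule runs_NStore)
    assume "bval (positive (edge_field 2)) s"
    then have M: "{x, y} \<in> M" using ev by simp
    have 1: "((fst s)(nval (degree_cell (edge_field 0)) s :=
        nval (NAdd (NLoad (degree_cell (edge_field 0))) (NConst 1)) s), snd s) = ?s"
      using I e ev h by simp
    have 2: "((fst ?s)(nval (degree_cell (edge_field 1)) ?s :=
        nval (NAdd (NLoad (degree_cell (edge_field 1))) (NConst 1)) ?s), snd ?s) = ?t"
      using I e ev' h' by simp
    show "(\<lambda>s'. header s' \<and> fst s' (base + 2) = j \<and> input ((fst s')(base + 2 := Suc j), snd s') \<and>
       (\<forall>v<n. fst ((fst s')(base + 2 := Suc j), snd s') (base + 5 + v) = incidences (Suc j) v \<and>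
          fst ((fst s')(base + 2 := Suc j), snd s') (base + 5 + n + v) = 0))
      ((fst ((fst s)(nval (degree_cell (edge_field 0)) s :=
           nval (NAdd (NLoad (degree_cell (edge_field 0))) (NConst 1)) s), snd s))
        (nval (degree_cell (edge_field 1)) ((fst s)(nval (degree_cell (edge_field 0)) s :=
           nval (NAdd (NLoad (degree_cell (edge_field 0))) (NConst 1)) s), snd s) :=
         nval (NAdd (NLoad (degree_cell (edge_field 1))) (NConst 1))
          ((fst s)(nval (degree_cell (edge_field 0)) s :=
           nval (NAdd (NLoad (degree_cell (edge_field 0))) (NConst 1)) s), snd s)),
       snd ((fst s)(nval (degree_cell (edge_field 0)) s :=
           nval (NAdd (NLoad (degree_cell (edge_field 0))) (NConst 1)) s), snd s))"
      unfolding 1 2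
      using h'' t input_update[OF t, of "base + 2" "Suc j"] I e M j xy
      by (auto simp: incidences_Suc)
  next
    assume "\<not> bval (positive (edge_field 2)) s"
    then show "runs L Skip s (\<lambda>s'. header s' \<and> fst s' (base + 2) = j \<and> input ((fst s')(base + 2 := Suc j), snd s') \<and>
       (\<forall>v<n. fst ((fst s')(base + 2 := Suc j), snd s') (base + 5 + v) = incidences (Suc j) v \<and>
          fst ((fst s')(base + 2 := Suc j), snd s') (base + 5 + n + v) = 0))"
      using h I input_update[of s "base + 2" "Suc j"] j xy ev by (intro runs_Skip) (auto simp: incidences_Suc)
  qed
next
  show "input ((fst s0)(base + 2 := 0), snd s0) \<and> (\<forall>v<n. fst ((fst s0)(base + 2 := 0), snd s0) (base + 5 + v)
      = incidences 0 v \<and> fst ((fst s0)(base + 2 := 0), snd s0) (base + 5 + n + v) = 0)"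
    using input_update[OF s0(1), of "base + 2" 0] s0(2) by (simp add: incidences_def)
qed (use L s0 input_header in \<open>auto simp: loaded_def incidences_all\<close>)

section \<open>Greedy choice of disjoint pairs\<close>

definition sol :: "state \<Rightarrow> nat set" where
  "sol s = {v. v < n \<and> fst s (base + 5 + n + v) \<noteq> 0}"

text \<open>The marked vertices come in disjoint pairs, each of which meets every stabilizer.\<close>

definition selection :: "(nat \<times> nat) set \<Rightarrow> nat set \<Rightarrow> bool" where
  "selection P S \<longleftrightarrow> S \<subseteq> exposed \<and> (\<forall>S'. stabilizer S' \<longrightarrow> card S \<le> 2 * card (S \<inter> S')) \<and>
     (\<forall>(a, b) \<in> P. a \<in> exposed - S \<longrightarrow> b \<in> exposed - S \<longrightarrow> \<not> pos_cycle (set (arcs (active a b))))"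

lemma selection_skip:
  assumes "selection P S"
    and "a \<in> exposed - S \<Longrightarrow> b \<in> exposed - S \<Longrightarrow> \<not> pos_cycle (set (arcs (active a b)))"
  shows "selection (insert (a, b) P) S"
  using assms unfolding selection_def by auto

text \<open>A stabilizer contains \<open>a\<close> or \<open>b\<close>, and neither lies in
  \<open>S\<close>. So the intersection grows by at least one while the set grows by at most two,
  also if \<open>a = b\<close>. Settled pairs stay settled because \<open>exposed - S\<close>
  shrinks.\<close>

lemma selection_add:
  assumes sel: "selection P S" and ab: "a \<in> exposed - S" "b \<in> exposed - S"
    and pos: "pos_cycle (set (arcs (active a b)))"
  shows "selection (insert (a, b) P) (insert a (insert b S))"
proof -
  have "finite exposed" by (simp add: exposed_def)
  then have fin: "finite S" using sel finite_subset unfolding selection_def by blast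
  have "card (insert a (insert b S)) \<le> 2 * card (insert a (insert b S) \<inter> S')" if "stabilizer S'" for S'
  proof -
    have "a \<in> S' \<or> b \<in> S'" using stabilizer_active[OF that] pos by blast
    then obtain z where z: "z \<in> {a, b}" "z \<in> S'" by blast
    have "card (insert a (insert b S)) \<le> card S + 2" using fin by (simp add: card_insert_if)
    also have "card S \<le> 2 * card (S \<inter> S')" using sel that unfolding selection_def by blast
    also have "2 * card (S \<inter> S') + 2 = 2 * card (insert z (S \<inter> S'))" using z ab fin by auto
    also have "card (insert z (S \<inter> S')) \<le> card (insert a (insert b S) \<inter> S')"
      using z fin by (intro card_mono) auto
    finally show ?thesis by simp
  qed
  then show ?thesis using sel ab unfolding selection_def by auto
qed

lemma loaded_update:
  assumes "loaded s" "base \<le> i" "i < base + 5 \<or> base + 5 + n \<le> i"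
  shows "loaded ((fst s)(i := x), snd s)"
  using assms input_update[of s i x] unfolding loaded_def by auto

lemma sol_update: "i < base + 5 + n \<Longrightarrow> sol ((fst s)(i := x), snd s) = sol s"
  by (auto simp: sol_def)

lemma sol_mark: "v < n \<Longrightarrow> sol ((fst s)(base + 5 + n + v := 1), snd s) = insert v (sol s)"
  by (auto simp: sol_def)

lemma loaded_header: "loaded s \<Longrightarrow> header s"
  by (simp add: loaded_def input_header)

lemma bval_is_free:
  assumes "loaded s" "nval e s < n"
  shows "bval (is_free e) s \<longleftrightarrow> nval e s \<in> exposed - sol s"
  using assms loaded_header[OF assms(1)] by (auto simp: is_free_def exposed_def sol_def loaded_def)

lemma runs_test_pair:
  assumes s: "testing a b s" "selection P (sol s)" "a < n" "b < n" and L: "m \<le> L" "2 * n + 2 \<le> L"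
  shows "runs L (Cond (BAnd (is_free first) (is_free second))
       (Seq find_pos_cycle
         (Cond (positive (NLoad flag))
           (Seq (NStore (solution_cell first) (NConst 1)) (NStore (solution_cell second) (NConst 1))) Skip))
       Skip) s (\<lambda>s'. testing a b s' \<and> selection (insert (a, b) P) (sol s'))"
proof -
  have ev: "header s'" "nval first s' = a" "nval second s' = b" if "testing a b s'" for s'
    using that testing_header[OF that] by (simp_all add: testing_def)
  have loaded: "loaded s'" if "testing a b s'" for s' using that by (simp add: testing_def)
  have free: "bval (BAnd (is_free first) (is_free second)) s \<longleftrightarrow> a \<in> exposed - sol s \<and> b \<in> exposed - sol s"
    using bval_is_free[OF loaded[OF s(1)], of first] bval_is_free[OF loaded[OF s(1)], of second] ev[OF s(1)] s
    by (simp del: nval.simps)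
  show ?thesis
  proof (rule runs_Cond)
    assume "bval (BAnd (is_free first) (is_free second)) s"
    then have ab: "a \<in> exposed - sol s" "b \<in> exposed - sol s" using free by auto
    show "runs L (Seq find_pos_cycle (Cond (positive (NLoad flag))
           (Seq (NStore (solution_cell first) (NConst 1)) (NStore (solution_cell second) (NConst 1))) Skip)) s
        (\<lambda>s'. testing a b s' \<and> selection (insert (a, b) P) (sol s'))"
    proof (rule runs_Seq, rule runs_conseq[OF runs_find_pos_cycle[OF s(1) L]], elim conjE)
      fix s1 assume p: "preserved s s1" and pos: "(0 < fst s1 base) = pos_cycle (set (arcs (active a b)))"
      have t: "testing a b s1" by (rule preserved_testing[OF p s(1)])
      have sol1: "sol s1 = sol s" using p unfolding sol_def preserved_def by auto
      let ?s2 = "((fst s1)(base + 5 + n + a := 1), snd s1)"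
      let ?s3 = "((fst ?s2)(base + 5 + n + b := 1), snd ?s2)"
      have t2: "testing a b ?s2" using t loaded_update[OF loaded[OF t], of "base + 5 + n + a" 1]
        by (simp add: testing_def)
      have t3: "testing a b ?s3" using t2 loaded_update[OF loaded[OF t2], of "base + 5 + n + b" 1]
        unfolding testing_def by simp
      have "sol ?s3 = insert b (insert a (sol s))"
        using sol_mark[OF s(4), of ?s2] sol_mark[OF s(3), of s1] sol1 by simp
      then have sol3: "sol ?s3 = insert a (insert b (sol s))" by blast
      have e1: "((fst s1)(nval (solution_cell first) s1 := nval (NConst 1) s1), snd s1) = ?s2"
        using ev[OF t] by simp
      have e2: "((fst ?s2)(nval (solution_cell second) ?s2 := nval (NConst 1) ?s2), snd ?s2) = ?s3"
        using ev[OF t2] by simp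
      show "runs L (Cond (positive (NLoad flag))
           (Seq (NStore (solution_cell first) (NConst 1)) (NStore (solution_cell second) (NConst 1))) Skip) s1
        (\<lambda>s'. testing a b s' \<and> selection (insert (a, b) P) (sol s'))"
      proof (rule runs_Cond, rule runs_Seq, rule runs_NStore, unfold e1, rule runs_NStore, unfold e2)
        assume "bval (positive (NLoad flag)) s1"
        then have "pos_cycle (set (arcs (active a b)))" using pos ev[OF t] by simp
        from selection_add[OF s(2) ab this] show "testing a b ?s3 \<and> selection (insert (a, b) P) (sol ?s3)"
          unfolding sol3 using t3 by blast
      next
        assume "\<not> bval (positive (NLoad flag)) s1"
        then have "\<not> pos_cycle (set (arcs (active a b)))" using pos ev[OF t] by simp
        then show "runs L Skip s1 (\<lambda>s'. testing a b s' \<and> selection (insert (a, b) P) (sol s'))"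
          using t sol1 selection_skip[OF s(2)] by (intro runs_Skip) simp
      qed
    qed
  next
    assume "\<not> bval (BAnd (is_free first) (is_free second)) s"
    then show "runs L Skip s (\<lambda>s'. testing a b s' \<and> selection (insert (a, b) P) (sol s'))"
      using free s selection_skip[OF s(2), of a b] by (intro runs_Skip) blast
  qed
qed

lemma runs_select_pairs:
  assumes s0: "loaded s0" "sol s0 = {}" and L: "m \<le> L" "2 * n + 2 \<le> L"
  shows "runs L select_pairs s0
    (\<lambda>s. loaded s \<and> fst s (base + 3) = n \<and> selection ({..<n} \<times> {..<n}) (sol s))"
  unfolding select_pairs_def
proof (rule runs_for_loop[where B = n and I = "\<lambda>a s. loaded s \<and> selection ({..<a} \<times> {..<n}) (sol s)"])
  fix a s
  assume I: "loaded s \<and> selection ({..<a} \<times> {..<n}) (sol s)"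
  then show "header s \<and> nval num_vertices s = n" using loaded_header by (simp add: header_def)
  assume a: "a < n" "fst s (base + 3) = a"
  show "runs L (for_loop 4 num_vertices
     (Cond (BAnd (is_free first) (is_free second))
       (Seq find_pos_cycle
         (Cond (positive (NLoad flag))
           (Seq (NStore (solution_cell first) (NConst 1)) (NStore (solution_cell second) (NConst 1))) Skip))
       Skip)) s (\<lambda>s'. header s' \<and> fst s' (base + 3) = a \<and> loaded ((fst s')(base + 3 := Suc a), snd s') \<and>
        selection ({..<Suc a} \<times> {..<n}) (sol ((fst s')(base + 3 := Suc a), snd s')))"
  proof (rule runs_for_loop[where B = n and I = "\<lambda>b s. loaded s \<and> fst s (base + 3) = a \<and>
       selection ({..<a} \<times> {..<n} \<union> {a} \<times> {..<b}) (sol s)"])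
    fix b s
    assume I: "loaded s \<and> fst s (base + 3) = a \<and> selection ({..<a} \<times> {..<n} \<union> {a} \<times> {..<b}) (sol s)"
    then show "header s \<and> nval num_vertices s = n" using loaded_header by (simp add: header_def)
    assume b: "b < n" "fst s (base + 4) = b"
    have t: "testing a b s" using I b by (simp add: testing_def)
    have P: "insert (a, b) ({..<a} \<times> {..<n} \<union> {a} \<times> {..<b}) = {..<a} \<times> {..<n} \<union> {a} \<times> {..<Suc b}"
      by auto
    show "runs L (Cond (BAnd (is_free first) (is_free second))
       (Seq find_pos_cycle
         (Cond (positive (NLoad flag))
           (Seq (NStore (solution_cell first) (NConst 1)) (NStore (solution_cell second) (NConst 1))) Skip))
       Skip) s (\<lambda>s'. header s' \<and> fst s' (base + 4) = b \<and> loaded ((fst s')(base + 4 := Suc b), snd s') \<and>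
         fst ((fst s')(base + 4 := Suc b), snd s') (base + 3) = a \<and>
        selection ({..<a} \<times> {..<n} \<union> {a} \<times> {..<Suc b}) (sol ((fst s')(base + 4 := Suc b), snd s')))"
    proof (rule runs_conseq[OF runs_test_pair[OF t _ a(1) b(1) L]])
      show "selection ({..<a} \<times> {..<n} \<union> {a} \<times> {..<b}) (sol s)" using I by blast
      fix s' assume "testing a b s' \<and> selection (insert (a, b) ({..<a} \<times> {..<n} \<union> {a} \<times> {..<b})) (sol s')"
      then show "header s' \<and> fst s' (base + 4) = b \<and> loaded ((fst s')(base + 4 := Suc b), snd s') \<and>
         fst ((fst s')(base + 4 := Suc b), snd s') (base + 3) = a \<and>
        selection ({..<a} \<times> {..<n} \<union> {a} \<times> {..<Suc b}) (sol ((fst s')(base + 4 := Suc b), snd s'))"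
        unfolding P using testing_header[of a b s'] loaded_update[of s' "base + 4" "Suc b"]
        by (simp add: testing_def sol_update)
    qed
  next
    show "loaded ((fst s)(base + 4 := 0), snd s) \<and> fst ((fst s)(base + 4 := 0), snd s) (base + 3) = a \<and>
       selection ({..<a} \<times> {..<n} \<union> {a} \<times> {..<0}) (sol ((fst s)(base + 4 := 0), snd s))"
      using I a loaded_update[of s "base + 4" 0] by (simp add: sol_update)
  next
    fix s' assume "loaded s' \<and> fst s' (base + 3) = a \<and> selection ({..<a} \<times> {..<n} \<union> {a} \<times> {..<n}) (sol s')"
    moreover have "{..<a} \<times> {..<n} \<union> {a} \<times> {..<n} = {..<Suc a} \<times> {..<n}" by auto
    ultimately show "header s' \<and> fst s' (base + 3) = a \<and> loaded ((fst s')(base + 3 := Suc a), snd s') \<and>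
        selection ({..<Suc a} \<times> {..<n}) (sol ((fst s')(base + 3 := Suc a), snd s'))"
      using loaded_header[of s'] loaded_update[of s' "base + 3" "Suc a"] by (simp add: sol_update)
  qed (use L I loaded_header in auto)
next
  show "loaded ((fst s0)(base + 3 := 0), snd s0) \<and> selection ({..<0} \<times> {..<n}) (sol ((fst s0)(base + 3 := 0), snd s0))"
    using loaded_update[OF s0(1), of "base + 3" 0] s0(2) by (simp add: sol_update selection_def)
qed (use L s0 loaded_header in auto)

lemma runs_write_solution:
  assumes s0: "header s0" and L: "n \<le> L"
  shows "runs L write_solution s0 (\<lambda>s. reported_solution n s = Some (sol s0))"
  unfolding write_solution_def
\<comment> \<open>The bound is \<open>v \<le> n\<close> because the last round reads the cell just
  past the solution.\<close>
proof (rule runs_Seq, rule runs_for_loop[where B = n and I = "\<lambda>j s. header s \<and>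
    (\<forall>v\<le>n. fst s (base + 5 + n + v) = fst s0 (base + 5 + n + v)) \<and>
    (\<forall>v<j. fst s (2 + v) = fst s0 (base + 5 + n + Suc v))"])
  fix j s
  assume I: "header s \<and> (\<forall>v\<le>n. fst s (base + 5 + n + v) = fst s0 (base + 5 + n + v)) \<and>
    (\<forall>v<j. fst s (2 + v) = fst s0 (base + 5 + n + Suc v))"
  then show "header s \<and> nval num_vertices s = n" by (simp add: header_def)
  assume j: "j < n" "fst s (base + 2) = j"
  \<comment> \<open>Target cells lie below the work area, so no counter and no unread mark is
    destroyed.\<close>
  have lt: "2 + j < base" using j by (simp add: base_def)
  have h: "header s" using I by blast
  have val: "fst s (base + 5 + n + Suc j) = fst s0 (base + 5 + n + Suc j)" using I j by (meson Suc_leI)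
  show "runs L (NStore (NAdd (NConst 2) index) (NLoad (solution_cell (NAdd index (NConst 1))))) s
     (\<lambda>s'. header s' \<and> fst s' (base + 2) = j \<and> header ((fst s')(base + 2 := Suc j), snd s') \<and>
    (\<forall>v\<le>n. fst ((fst s')(base + 2 := Suc j), snd s') (base + 5 + n + v) = fst s0 (base + 5 + n + v)) \<and>
    (\<forall>v<Suc j. fst ((fst s')(base + 2 := Suc j), snd s') (2 + v) = fst s0 (base + 5 + n + Suc v)))"
    using I j lt header_update[OF _ h] val h
    by (intro runs_NStore) (auto simp: less_Suc_eq header_def)
next
  show "header ((fst s0)(base + 2 := 0), snd s0) \<and>
    (\<forall>v\<le>n. fst ((fst s0)(base + 2 := 0), snd s0) (base + 5 + n + v) = fst s0 (base + 5 + n + v)) \<and>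
    (\<forall>v<0. fst ((fst s0)(base + 2 := 0), snd s0) (2 + v) = fst s0 (base + 5 + n + Suc v))"
    using s0 by (simp add: header_def base_def)
next
  fix s
  assume I: "header s \<and> (\<forall>v\<le>n. fst s (base + 5 + n + v) = fst s0 (base + 5 + n + v)) \<and>
    (\<forall>v<n. fst s (2 + v) = fst s0 (base + 5 + n + Suc v))"
  then have h: "header s" by blast
  have 0: "fst s (base + 5 + n) = fst s0 (base + 5 + n)" using I by (metis add.right_neutral le0)
  let ?s1 = "((fst s)(1 := fst s0 (base + 5 + n)), snd s)"
  let ?s2 = "((fst ?s1)(0 := 1), snd ?s1)"
  have cells: "fst ?s2 (Suc v) = fst s0 (base + 5 + n + v)" if "v < n" for v
  proof (cases v)
    case (Suc u)
    then have "fst s (2 + u) = fst s0 (base + 5 + n + Suc u)" using I that by simp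
    then show ?thesis using Suc by (simp add: numeral_2_eq_2)
  qed simp
  have "reported_solution n ?s2 = Some {v. v < n \<and> fst ?s2 (Suc v) \<noteq> 0}" by (simp add: reported_solution_def)
  also have "{v. v < n \<and> fst ?s2 (Suc v) \<noteq> 0} = sol s0"
    unfolding sol_def using cells by (intro Collect_cong) metis
  finally have r: "reported_solution n ?s2 = Some (sol s0)" .
  have e1: "((fst s)(nval (NConst 1) s := nval (NLoad (solution_cell (NConst 0))) s), snd s) = ?s1"
    using h 0 by simp
  show "runs L (Seq (NStore (NConst 1) (NLoad (solution_cell (NConst 0)))) (NStore (NConst 0) (NConst 1))) s
     (\<lambda>s. reported_solution n s = Some (sol s0))"
    by (rule runs_Seq, rule runs_NStore, unfold e1, rule runs_NStore) (use r in simp)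
qed (use L s0 in auto)

section \<open>Initial memory and the complete program\<close>

lemma initial_input:
  "input (initial_state n es w c M)" "base \<le> i \<Longrightarrow> fst (initial_state n es w c M) i = 0"
proof -
  let ?f = "\<lambda>u v. if {u, v} \<in> M then 1 else 0 :: nat"
  let ?t = "concat (map (\<lambda>(u, v). [u, v, ?f u v]) es)"
  let ?l = "nat_input n es c M"
  have l: "?l = [n, m] @ map c [0..<n] @ ?t" by (simp add: nat_input_def)
  have len: "length ?t = 3 * m" by (rule length_concat_triples)
  have "length ?l = base" unfolding l base_def by (simp add: len)
  then show "base \<le> i \<Longrightarrow> fst (initial_state n es w c M) i = 0"
    by (simp add: initial_state_def load_memory_def)
  have mem: "fst (initial_state n es w c M) i = ?l ! i" if "i < base" for i
    using that \<open>length ?l = base\<close> by (simp add: initial_state_def load_memory_def)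
  have cap: "?l ! (2 + v) = c v" if "v < n" for v
    unfolding l using that by (simp add: nth_append)
  have edge: "?l ! (2 + k + n + 3 * j) = [fst (es ! j), snd (es ! j), ?f (fst (es ! j)) (snd (es ! j))] ! k"
    if "j < m" "k < 3" for j k
  proof -
    have "?l ! (2 + k + n + 3 * j) = ?t ! (3 * j + k)"
      unfolding l by (simp add: nth_append add.commute)
    then show ?thesis using nth_concat_triples[OF that, of ?f] by simp
  qed
  have "snd (initial_state n es w c M) j = w {fst (es ! j), snd (es ! j)}" if "j < m" for j
    using that by (simp add: initial_state_def load_memory_def real_input_def case_prod_beta)
  moreover have "fst (initial_state n es w c M) (2 + n + 3 * j) = fst (es ! j)"
    "fst (initial_state n es w c M) (3 + n + 3 * j) = snd (es ! j)"
    "0 < fst (initial_state n es w c M) (4 + n + 3 * j) \<longleftrightarrow> {fst (es ! j), snd (es ! j)} \<in> M" if "j < m" for j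
    using edge[OF that, of 0] edge[OF that, of 1] edge[OF that, of 2] mem that
    by (simp_all add: base_def)
  moreover have "header (initial_state n es w c M)"
    unfolding header_def using mem by (simp add: l base_def)
  moreover have "fst (initial_state n es w c M) (2 + v) = c v" if "v < n" for v
    using mem[of "2 + v"] cap[OF that] that by (simp add: base_def)
  ultimately show "input (initial_state n es w c M)" unfolding input_def by blast
qed

lemma runs_stabilizer_com:
  assumes L: "m \<le> L" "2 * n + 2 \<le> L"
  shows "runs L stabilizer_com (initial_state n es w c M) (\<lambda>s.
    if \<exists>S. stabilizer S
    then \<exists>S. reported_solution n s = Some S \<and> stabilizer S \<and> (\<forall>S'. stabilizer S' \<longrightarrow> card S \<le> 2 * card S')
    else reported_solution n s = None)" (is "runs L _ _ ?Q")
  unfolding stabilizer_com_def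
proof (rule runs_Seq, rule runs_conseq[OF runs_compute_degrees[OF initial_input L(1)]], assumption)
  fix s1 assume "loaded s1 \<and> (\<forall>v<n. fst s1 (base + 5 + n + v) = 0)"
  then have s1: "loaded s1" "sol s1 = {}" by (auto simp: sol_def)
  show "runs L (Seq select_pairs (Seq (NStore (var 4) num_vertices) (Seq find_pos_cycle
      (Cond (positive (NLoad flag)) (NStore (NConst 0) (NConst 0)) write_solution)))) s1 ?Q"
  proof (rule runs_Seq, rule runs_conseq[OF runs_select_pairs[OF s1 L]], rule runs_Seq, rule runs_NStore)
    fix s2 assume s2: "loaded s2 \<and> fst s2 (base + 3) = n \<and> selection ({..<n} \<times> {..<n}) (sol s2)"
    let ?s = "((fst s2)(nval (var 4) s2 := nval num_vertices s2), snd s2)"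
    have s_eq: "?s = ((fst s2)(base + 4 := n), snd s2)"
      using s2 loaded_header[of s2] by (simp add: header_def[of s2])
    have t: "testing n n ?s" unfolding s_eq
      using s2 loaded_update[of s2 "base + 4" n] by (simp add: testing_def)
    have sol_s: "sol ?s = sol s2" unfolding s_eq by (simp add: sol_update)
    show "runs L (Seq find_pos_cycle (Cond (positive (NLoad flag)) (NStore (NConst 0) (NConst 0)) write_solution)) ?s ?Q"
    proof (rule runs_Seq, rule runs_conseq[OF runs_find_pos_cycle[OF t L]], elim conjE)
      fix s3 assume p: "preserved ?s s3" and pos: "(0 < fst s3 base) = pos_cycle (set (arcs (active n n)))"
      have h: "header s3" by (rule testing_header[OF preserved_testing[OF p t]])
      have "sol s3 = sol ?s" using p unfolding sol_def preserved_def by auto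
      then have sel: "selection ({..<n} \<times> {..<n}) (sol s3)" using s2 sol_s by simp
      show "runs L (Cond (positive (NLoad flag)) (NStore (NConst 0) (NConst 0)) write_solution) s3 ?Q"
      proof (rule runs_Cond, rule runs_NStore)
        assume "bval (positive (NLoad flag)) s3"
        then have "pos_cycle (set (arcs (active n n)))" using pos h by simp
        \<comment> \<open>Stabilizers consist of exposed vertices and hence never contain
          \<open>n\<close>.\<close>
        then have "\<not> stabilizer S" for S
          using stabilizer_active[of S n n] unfolding stabilizer_iff exposed_def by blast
        then show "?Q ((fst s3)(nval (NConst 0) s3 := nval (NConst 0) s3), snd s3)"
          by (simp add: reported_solution_def)
      next
        assume "\<not> bval (positive (NLoad flag)) s3"
        then have no: "\<not> pos_cycle (set (arcs (active n n)))" using pos h by simp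
        have stab: "stabilizer (sol s3)"
          by (rule stabilizer_if_pairs[OF no]) (use sel in \<open>auto simp: selection_def exposed_def\<close>)
        have "card (sol s3) \<le> 2 * card S'" if "stabilizer S'" for S'
        proof -
          have "finite S'" using that unfolding stabilizer_iff exposed_def by (auto intro: finite_subset[of _ "{..<n}"])
          then have "card (sol s3 \<inter> S') \<le> card S'" by (simp add: card_mono)
          moreover have "card (sol s3) \<le> 2 * card (sol s3 \<inter> S')" using sel that unfolding selection_def by blast
          ultimately show ?thesis by linarith
        qed
        with stab show "runs L write_solution s3 ?Q"
          using L by (intro runs_conseq[OF runs_write_solution[OF h]]) auto
      qed
    qed
  qed
qed

end

theorem theorem5:
  "\<exists>(P :: com) (p :: nat poly).
     \<forall>(n :: nat) (E :: nat set set) (w :: nat set \<Rightarrow> real) (c :: nat \<Rightarrow> nat) (M :: nat set set)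
       (es :: (nat \<times> nat) list).
       simple_graph {..<n} E \<and> (\<forall>e\<in>E. 0 \<le> w e) \<and> c_matching {..<n} E c M \<and> edge_list E es \<longrightarrow>
       (\<exists>t s. exec P (initial_state n es w c M) t s \<and>
          t \<le> poly p (input_size n es w c M) \<and>
          (if \<exists>S. M_vertex_stabilizer {..<n} E w c M S
           then \<exists>S. reported_solution n s = Some S \<and> M_vertex_stabilizer {..<n} E w c M S \<and>
                  (\<forall>S'. M_vertex_stabilizer {..<n} E w c M S' \<longrightarrow> card S \<le> 2 * card S')
           else reported_solution n s = None))"
proof -
  obtain q :: "nat poly" where q: "\<And>L. cost_bound L stabilizer_com = poly q L"
    using cost_bound_poly by blast
  show ?thesis
  \<comment> \<open>No loop has more than \<open>m\<close> or \<open>2 * n + 2\<close> rounds, and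
    the input has at least \<open>2 + n + m\<close> cells, so twice the input size serves as
    \<open>L\<close>; composing with \<open>[:0, 2:]\<close> substitutes it.\<close>
  proof (intro exI[of _ stabilizer_com] exI[of _ "pcompose q [:0, 2:]"] allI impI, elim conjE)
    fix n E w c M es
    assume "simple_graph {..<n} E" "c_matching {..<n} E c M" "edge_list E es"
    then interpret matching_instance n E w c M es by unfold_locales
    let ?L = "2 * input_size n es w c M"
    have "2 + n + length es \<le> input_size n es w c M"
      by (simp add: input_size_def nat_input_def real_input_def)
    then have "runs ?L stabilizer_com (initial_state n es w c M) (\<lambda>s.
      if \<exists>S. stabilizer S
      then \<exists>S. reported_solution n s = Some S \<and> stabilizer S \<and> (\<forall>S'. stabilizer S' \<longrightarrow> card S \<le> 2 * card S')
      else reported_solution n s = None)"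
      by (intro runs_stabilizer_com) simp_all
    then show "\<exists>t s. exec stabilizer_com (initial_state n es w c M) t s \<and>
          t \<le> poly (pcompose q [:0, 2:]) (input_size n es w c M) \<and>
          (if \<exists>S. stabilizer S
           then \<exists>S. reported_solution n s = Some S \<and> stabilizer S \<and>
                  (\<forall>S'. stabilizer S' \<longrightarrow> card S \<le> 2 * card S')
           else reported_solution n s = None)"
      unfolding runs_def q by (simp add: poly_pcompose mult.commute)
  qed
qed

end
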